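(* Let $\mathbf{k}\ge 2$ and $\varphi\ge 2$ be integers such that $\mathbf{Bl}(\mathbf{k},\varphi)$ is nonempty. A block graph $G\in\mathbf{Bl}(\mathbf{k},\varphi)$ is a graph with maximal spectral radius in $\mathbf{Bl}(\mathbf{k},\varphi)$ if and only if $G\cong\mathbb{B}_{\mathbf{k},\varphi}$, where $\mathbb{B}_{\mathbf{k},\varphi}$ is the block graph with a single central cut vertex $c$ whose blocks (all containing $c$) are: if $\varphi$ is odd, one $K_2$, $\frac{\varphi-3}{2}$ copies of $K_3$ and one $K_{\mathbf{k}-\varphi+2}$; if $\varphi$ is even, $\frac{\varphi-2}{2}$ copies of $K_3$ and one $K_{\mathbf{k}-\varphi+2}$. In particular, the maximum of $\rho(G)$ over $G\in\mathbf{Bl}(\mathbf{k},\varphi)$ is attained uniquely (up to isomorphism) by $\mathbb{B}_{\mathbf{k},\varphi}$.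
   Context: All graphs are finite, simple and connected. A block of $G$ is a maximal connected subgraph without a cut vertex. A block graph is a connected graph each of whose blocks is a complete graph. A dissociation set is a vertex set inducing a subgraph of maximum degree at most $1$; the dissociation number $\varphi(G)$ is the maximum size of one. $\mathbf{Bl}(\mathbf{k},\varphi)$ is the class of block graphs on $\mathbf{k}$ vertices with dissociation number $\varphi$. $\rho(G)$ is the spectral radius of the adjacency matrix of $G$. $\widehat G\in\mathbf{Bl}(\mathbf{k},\varphi)$ is a graph with maximal spectral radius in $\mathbf{Bl}(\mathbf{k},\varphi)$ if $\rho(G)\le\rho(\widehat G)$ for all $G\in\mathbf{Bl}(\mathbf{k},\varphi)$. *)

theory Defs
  imports "Jordan_Normal_Form.Spectral_Radius"
begin

definition simple_graph_on :: "nat \<Rightarrow> (nat \<Rightarrow> nat \<Rightarrow> bool) \<Rightarrow> bool" where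
  "simple_graph_on k E \<longleftrightarrow>
     (\<forall>x y. E x y \<longrightarrow> x < k \<and> y < k) \<and>
     (\<forall>x y. E x y \<longrightarrow> E y x) \<and> (\<forall>x. \<not> E x x)"

definition connected_on :: "(nat \<Rightarrow> nat \<Rightarrow> bool) \<Rightarrow> nat set \<Rightarrow> bool" where
  "connected_on E S \<longleftrightarrow>
     (\<forall>x\<in>S. \<forall>y\<in>S. (\<lambda>a b. E a b \<and> a \<in> S \<and> b \<in> S)\<^sup>*\<^sup>* x y)"

definition nonseparable_on :: "(nat \<Rightarrow> nat \<Rightarrow> bool) \<Rightarrow> nat set \<Rightarrow> bool" where
  "nonseparable_on E S \<longleftrightarrow> connected_on E S \<and> (\<forall>v\<in>S. connected_on E (S - {v}))"

text \<open>A block: a maximal nonempty vertex set inducing a connected subgraph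
  without cut vertex (maximal subgraphs of this kind are induced).\<close>
definition is_block :: "nat \<Rightarrow> (nat \<Rightarrow> nat \<Rightarrow> bool) \<Rightarrow> nat set \<Rightarrow> bool" where
  "is_block k E S \<longleftrightarrow> S \<noteq> {} \<and> S \<subseteq> {0..<k} \<and> nonseparable_on E S \<and>
     (\<forall>T. S \<subset> T \<and> T \<subseteq> {0..<k} \<longrightarrow> \<not> nonseparable_on E T)"

definition block_graph :: "nat \<Rightarrow> (nat \<Rightarrow> nat \<Rightarrow> bool) \<Rightarrow> bool" where
  "block_graph k E \<longleftrightarrow> simple_graph_on k E \<and> connected_on E {0..<k} \<and>
     (\<forall>S. is_block k E S \<longrightarrow> (\<forall>x\<in>S. \<forall>y\<in>S. x \<noteq> y \<longrightarrow> E x y))"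

definition dissociation_set :: "nat \<Rightarrow> (nat \<Rightarrow> nat \<Rightarrow> bool) \<Rightarrow> nat set \<Rightarrow> bool" where
  "dissociation_set k E D \<longleftrightarrow> D \<subseteq> {0..<k} \<and> (\<forall>x\<in>D. card {y\<in>D. E x y} \<le> 1)"

definition dissociation_number :: "nat \<Rightarrow> (nat \<Rightarrow> nat \<Rightarrow> bool) \<Rightarrow> nat" where
  "dissociation_number k E = Max (card ` {D. dissociation_set k E D})"

definition adjacency_matrix :: "nat \<Rightarrow> (nat \<Rightarrow> nat \<Rightarrow> bool) \<Rightarrow> complex mat" where
  "adjacency_matrix k E = mat k k (\<lambda>(i, j). if E i j then 1 else 0)"

definition graph_spectral_radius :: "nat \<Rightarrow> (nat \<Rightarrow> nat \<Rightarrow> bool) \<Rightarrow> real" where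
  "graph_spectral_radius k E = spectral_radius (adjacency_matrix k E)"

definition Bl :: "nat \<Rightarrow> nat \<Rightarrow> (nat \<Rightarrow> nat \<Rightarrow> bool) set" where
  "Bl k \<phi> = {E. block_graph k E \<and> dissociation_number k E = \<phi>}"

definition max_spectral_radius_in :: "nat \<Rightarrow> nat \<Rightarrow> (nat \<Rightarrow> nat \<Rightarrow> bool) \<Rightarrow> bool" where
  "max_spectral_radius_in k \<phi> G \<longleftrightarrow> G \<in> Bl k \<phi> \<and>
     (\<forall>E \<in> Bl k \<phi>. graph_spectral_radius k E \<le> graph_spectral_radius k G)"

definition graph_iso :: "nat \<Rightarrow> (nat \<Rightarrow> nat \<Rightarrow> bool) \<Rightarrow> (nat \<Rightarrow> nat \<Rightarrow> bool) \<Rightarrow> bool" where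
  "graph_iso k E F \<longleftrightarrow> (\<exists>f. bij_betw f {0..<k} {0..<k} \<and>
     (\<forall>x\<in>{0..<k}. \<forall>y\<in>{0..<k}. E x y \<longleftrightarrow> F (f x) (f y)))"

text \<open>The extremal graph B_{k,phi}: vertex 0 is the central cut vertex c.
  With s = phi mod 2 and m = (phi - 2 - s) div 2, the non-central vertices
  1..s form the K2 block (only when phi is odd), vertices s+1..s+2m are paired
  into m copies of K3, and the remaining k - phi + 1 vertices together with c
  form a K_{k-phi+2}.  Two distinct vertices are adjacent iff one of them is c
  or they carry the same block label.\<close>
definition B_label :: "nat \<Rightarrow> nat \<Rightarrow> nat" where
  "B_label \<phi> i = (let s = \<phi> mod 2; m = (\<phi> - 2 - s) div 2 in
     if i \<le> s then 0
     else if i \<le> s + 2 * m then s + (i - s - 1) div 2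
     else s + m)"

definition B_graph :: "nat \<Rightarrow> nat \<Rightarrow> nat \<Rightarrow> nat \<Rightarrow> bool" where
  "B_graph k \<phi> x y \<longleftrightarrow> x < k \<and> y < k \<and> x \<noteq> y \<and>
     (x = 0 \<or> y = 0 \<or> B_label \<phi> x = B_label \<phi> y)"

end

theory Submission
  imports Defs "HOL-Analysis.Function_Topology" "HOL-Library.Transitive_Closure_Table"
begin

text \<open>Let \<open>x\<close> be the Perron vector of a block graph \<open>G\<close> and root \<open>G\<close> at a vertex \<open>u\<close> where \<open>x\<close> is
  maximal. Removing from every block its vertex closest to \<open>u\<close> partitions the other vertices into
  cliques. Reattaching all these cliques to \<open>u\<close> gives a fan, and replaces each edge from \<open>v\<close> to its
  parent by an edge to \<open>u\<close>, so the value of the adjacency form at \<open>x\<close> does not decrease. The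
  dissociation number of \<open>G\<close> is at most the sum of \<open>min 2 |P|\<close> over the cliques \<open>P\<close>. Among the
  partitions for which this sum is at least \<open>\<phi>\<close>, moving a vertex into a clique of larger total
  weight increases the form, so a maximising partition has at most one singleton, at most one
  clique of size at least 3, and capped sum exactly \<open>\<phi>\<close>: its fan is \<open>B\<^bsub>k,\<phi>\<^esub>\<close>. The Rayleigh
  principle turns the inequality of forms into one of spectral radii, and equality makes \<open>x\<close> an
  eigenvector of the fan, which forces \<open>G\<close> to be the fan itself.\<close>

section \<open>Rayleigh quotients and the spectral radius\<close>

text \<open>These rules would turn sums with \<open>of_bool\<close> factors into sums over filtered
  index sets; the factors are split and recombined algebraically below.\<close>

declare sum_of_bool_mult_eq [simp del] sum_mult_of_bool_eq [simp del]

text \<open>Entry \<open>i\<close> of the adjacency matrix applied to \<open>x\<close>. Vectors are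
  functions on all naturals, of which only the values below \<open>k\<close> count.\<close>

definition nbr_sum :: "nat \<Rightarrow> (nat \<Rightarrow> nat \<Rightarrow> bool) \<Rightarrow> (nat \<Rightarrow> real) \<Rightarrow> nat \<Rightarrow> real" where
  "nbr_sum k E x i = (\<Sum>j = 0..<k. of_bool (E i j) * x j)"

text \<open>The quadratic form of the adjacency matrix. It runs over ordered pairs, so every
  undirected edge contributes twice.\<close>

definition adj_form :: "nat \<Rightarrow> (nat \<Rightarrow> nat \<Rightarrow> bool) \<Rightarrow> (nat \<Rightarrow> real) \<Rightarrow> real" where
  "adj_form k E x = (\<Sum>i = 0..<k. x i * nbr_sum k E x i)"

definition sq_sum :: "nat \<Rightarrow> (nat \<Rightarrow> real) \<Rightarrow> real" where
  "sq_sum k x = (\<Sum>i = 0..<k. (x i)\<^sup>2)"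

lemma sq_sum_nonneg: "0 \<le> sq_sum k x"
  unfolding sq_sum_def by (simp add: sum_nonneg)

lemma sq_sum_eq_0_iff: "sq_sum k x = 0 \<longleftrightarrow> (\<forall>i<k. x i = 0)"
  unfolding sq_sum_def by (subst sum_nonneg_eq_0_iff) auto

lemma sq_sum_pos: "i < k \<Longrightarrow> x i \<noteq> 0 \<Longrightarrow> 0 < sq_sum k x"
  using sq_sum_eq_0_iff[of k x] sq_sum_nonneg[of k x] by force

lemma adj_form_scale: "adj_form k E (\<lambda>i. c * x i) = c\<^sup>2 * adj_form k E x"
  unfolding adj_form_def nbr_sum_def
  by (simp add: sum_distrib_left power2_eq_square algebra_simps)

lemma sq_sum_scale: "sq_sum k (\<lambda>i. c * x i) = c\<^sup>2 * sq_sum k x"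
  unfolding sq_sum_def by (simp add: sum_distrib_left power_mult_distrib)

lemma nbr_sum_cong: "(\<And>i. i < k \<Longrightarrow> x i = y i) \<Longrightarrow> nbr_sum k E x = nbr_sum k E y"
  unfolding nbr_sum_def by (intro ext sum.cong) auto

lemma adj_form_cong: "(\<And>i. i < k \<Longrightarrow> x i = y i) \<Longrightarrow> adj_form k E x = adj_form k E y"
  unfolding adj_form_def using nbr_sum_cong[of k x y E] by (intro sum.cong) auto

lemma sq_sum_cong: "(\<And>i. i < k \<Longrightarrow> x i = y i) \<Longrightarrow> sq_sum k x = sq_sum k y"
  unfolding sq_sum_def by (intro sum.cong) auto

text \<open>Tychonoff's theorem for a \<open>k\<close>-dimensional cube: pinning the coordinates
  from \<open>k\<close> on to 0 keeps the set compact in the product topology.\<close>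

lemma compact_finite_cube:
  "compact {y :: nat \<Rightarrow> real. \<forall>i. y i \<in> (if i < k then {-1..1} else {0})}"
proof -
  let ?C = "PiE UNIV (\<lambda>i::nat. if i < k then {-1..1::real} else {0})"
  have "compactin (product_topology (\<lambda>_. euclidean) UNIV) ?C"
    by (subst compactin_PiE) auto
  then have "compact ?C"
    using euclidean_product_topology[symmetric] by (metis compactin_euclidean_iff)
  moreover have "?C = {y. \<forall>i. y i \<in> (if i < k then {-1..1} else {0})}"
    by (auto simp: PiE_UNIV_domain Pi_iff split: if_splits)
  ultimately show ?thesis by simp
qed

text \<open>The unit vectors form a closed part of the cube, so the continuous form has a maximum
  there; both sides of the inequality are homogeneous of degree 2 in \<open>y\<close>, which extends
  it to all vectors.\<close>

lemma rayleigh_quotient_attains_max: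
  assumes "k > 0"
  obtains x where "sq_sum k x = 1" "\<And>y. adj_form k E y \<le> adj_form k E x * sq_sum k y"
proof -
  let ?K = "{y :: nat \<Rightarrow> real. \<forall>i. y i \<in> (if i < k then {-1..1} else {0})}"
  let ?S = "?K \<inter> {y. sq_sum k y = 1}"
  have cont: "continuous_on A (\<lambda>y::nat \<Rightarrow> real. y i)" for A i
    by (rule continuous_on_product_then_coordinatewise) (rule continuous_on_id)
  have "continuous_on UNIV (sq_sum k)"
    unfolding sq_sum_def by (intro continuous_intros cont)
  then have "closed {y. sq_sum k y = 1}"
    by (intro closed_Collect_eq) auto
  then have "compact ?S"
    by (intro compact_Int_closed compact_finite_cube)
  moreover have "(\<lambda>i. if i = 0 then 1 else 0) \<in> ?S"
    using assms by (auto simp: sq_sum_def if_distrib[of "\<lambda>z. z\<^sup>2"] sum.delta cong: if_cong)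
  then have "?S \<noteq> {}" by (metis empty_iff)
  moreover have "continuous_on ?S (adj_form k E)"
    unfolding adj_form_def nbr_sum_def by (intro continuous_intros cont)
  ultimately obtain x where x: "x \<in> ?S" "\<forall>y\<in>?S. adj_form k E y \<le> adj_form k E x"
    using continuous_attains_sup[of ?S "adj_form k E"] by blast
  have "adj_form k E y \<le> adj_form k E x * sq_sum k y" for y
  proof (cases "sq_sum k y = 0")
    case True
    then have "adj_form k E y = 0"
      by (simp add: sq_sum_eq_0_iff adj_form_def)
    with True show ?thesis by simp
  next
    case False
    then have pos: "sq_sum k y > 0" using sq_sum_nonneg[of k y] by linarith
    define c where "c = 1 / sqrt (sq_sum k y)"
    \<comment> \<open>Truncation from \<open>k\<close> on puts the normalised vector into the
      compact set without changing the form or the norm.\<close>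
    define z where "z = (\<lambda>i. if i < k then c * y i else 0)"
    have c2: "c\<^sup>2 = 1 / sq_sum k y" using pos by (simp add: c_def power_divide)
    have z1: "sq_sum k z = 1"
      using sq_sum_cong[of k z "\<lambda>i. c * y i"] pos by (simp add: z_def sq_sum_scale c2)
    have "(z i)\<^sup>2 \<le> 1" if "i < k" for i
    proof -
      have "(z i)\<^sup>2 \<le> sq_sum k z"
        unfolding sq_sum_def using that by (intro member_le_sum) auto
      then show ?thesis using z1 by simp
    qed
    then have "\<bar>z i\<bar> \<le> 1" if "i < k" for i
      using that by (simp add: abs_square_le_1)
    then have "z \<in> ?S" using z1 by (force simp: z_def abs_le_iff)
    then have "adj_form k E z \<le> adj_form k E x" using x by blast
    moreover have "adj_form k E z = c\<^sup>2 * adj_form k E y"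
      using adj_form_cong[of k z "\<lambda>i. c * y i" E] by (simp add: z_def adj_form_scale)
    ultimately show ?thesis using pos by (simp add: c2 field_simps)
  qed
  with x that show thesis by blast
qed

text \<open>The first-order condition: for small \<open>t\<close> of the sign of \<open>c\<close>, a
  nonzero linear term would win.\<close>

lemma eq_0_if_linear_le_quadratic:
  fixes c d :: real
  assumes "\<And>t. t * c \<le> t\<^sup>2 * d"
  shows "c = 0"
proof (rule ccontr)
  assume c: "c \<noteq> 0"
  \<comment> \<open>Any positive \<open>e\<close> above \<open>d\<close> serves: at
    \<open>t = c / e\<close> the hypothesis becomes
    \<open>c\<^sup>2 * e \<le> c\<^sup>2 * d\<close>.\<close>
  define e where "e = \<bar>d\<bar> + 1"
  have e: "e > 0" "d < e" by (auto simp: e_def)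
  have "c / e * c \<le> (c / e)\<^sup>2 * d" using assms .
  then have "c\<^sup>2 * e \<le> c\<^sup>2 * d"
    using e by (simp add: field_simps power2_eq_square)
  moreover have "c\<^sup>2 * d < c\<^sup>2 * e" using c e by simp
  ultimately show False by linarith
qed

text \<open>Changing coordinate \<open>i\<close> by \<open>t\<close> keeps
  \<open>\<mu> * sq_sum - adj_form\<close> nonnegative, and this difference is 0 at
  \<open>t = 0\<close>. So its linear coefficient in \<open>t\<close> vanishes, which is the
  eigenvalue equation at \<open>i\<close>.\<close>

lemma rayleigh_maximizer_eigenvector:
  assumes sym: "\<And>i j. E i j \<Longrightarrow> E j i"
    and max: "\<And>y. adj_form k E y \<le> \<mu> * sq_sum k y"
    and eq: "adj_form k E x = \<mu> * sq_sum k x"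
    and i: "i < k"
  shows "nbr_sum k E x i = \<mu> * x i"
proof -
  have sym': "E i j = E j i" for i j using sym by blast
  have ineq: "t * (2 * (nbr_sum k E x i - \<mu> * x i)) \<le> t\<^sup>2 * (\<mu> - of_bool (E i i))" for t
  proof -
    define y where "y = (\<lambda>j. x j + t * of_bool (j = i))"
    have n: "nbr_sum k E y a = nbr_sum k E x a + t * of_bool (E a i)" for a
    proof -
      have "nbr_sum k E y a = (\<Sum>j = 0..<k. of_bool (E a j) * x j + (if j = i then t * of_bool (E a i) else 0))"
        unfolding nbr_sum_def y_def by (intro sum.cong) (auto simp: algebra_simps)
      then show ?thesis using i by (simp add: sum.distrib nbr_sum_def)
    qed
    have "adj_form k E y = (\<Sum>a = 0..<k. x a * nbr_sum k E x a + t * (of_bool (E i a) * x a)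
        + (if a = i then t * nbr_sum k E x i + t\<^sup>2 * of_bool (E i i) else 0))"
      unfolding adj_form_def n
    proof (intro sum.cong refl)
      fix a
      show "y a * (nbr_sum k E x a + t * of_bool (E a i)) =
          x a * nbr_sum k E x a + t * (of_bool (E i a) * x a)
          + (if a = i then t * nbr_sum k E x i + t\<^sup>2 * of_bool (E i i) else 0)"
        unfolding sym'[of a i] by (simp add: y_def algebra_simps power2_eq_square)
    qed
    also have "\<dots> = adj_form k E x + 2 * t * nbr_sum k E x i + t\<^sup>2 * of_bool (E i i)"
      using i by (simp add: sum.distrib adj_form_def sum_distrib_left[symmetric] nbr_sum_def[symmetric])
    finally have f: "adj_form k E y = adj_form k E x + 2 * t * nbr_sum k E x i + t\<^sup>2 * of_bool (E i i)" .
    have "sq_sum k y = (\<Sum>a = 0..<k. (x a)\<^sup>2 + (if a = i then 2 * t * x i + t\<^sup>2 else 0))"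
      unfolding sq_sum_def by (intro sum.cong refl) (auto simp: y_def power2_eq_square algebra_simps)
    also have "\<dots> = sq_sum k x + 2 * t * x i + t\<^sup>2"
      using i by (simp add: sum.distrib sq_sum_def)
    finally have s: "sq_sum k y = sq_sum k x + 2 * t * x i + t\<^sup>2" .
    show ?thesis using max[of y] eq unfolding f s by (simp add: algebra_simps)
  qed
  from eq_0_if_linear_le_quadratic[OF ineq] show ?thesis by simp
qed

text \<open>Adjacency entries are nonnegative, so a maximiser of the form may be taken entrywise
  nonnegative.\<close>

lemma adj_form_abs_ge: "adj_form k E x \<le> adj_form k E (\<lambda>i. \<bar>x i\<bar>)"
  unfolding adj_form_def nbr_sum_def sum_distrib_left
  by (intro sum_mono) (auto simp: of_bool_def abs_mult[symmetric])

lemma adjacency_matrix_mult_vec: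
  assumes "i < k" and "v \<in> carrier_vec k"
  shows "(adjacency_matrix k E *\<^sub>v v) $ i = (\<Sum>j = 0..<k. of_bool (E i j) * v $ j)"
  using assms unfolding adjacency_matrix_def
  by (auto simp: scalar_prod_def intro!: sum.cong)

text \<open>The Rayleigh maximum \<open>l\<close> is an eigenvalue, hence at most the spectral
  radius. Conversely an eigenvector of a complex eigenvalue of largest modulus yields a real test
  vector whose Rayleigh quotient is at least that modulus.\<close>

lemma spectral_radius_eq_rayleigh_max:
  assumes k: "k > 0" and sym: "\<And>i j. E i j \<Longrightarrow> E j i"
  obtains x where "sq_sum k x = 1" "\<And>i. 0 \<le> x i"
    "\<And>i. i < k \<Longrightarrow> nbr_sum k E x i = graph_spectral_radius k E * x i"
    "\<And>y. adj_form k E y \<le> graph_spectral_radius k E * sq_sum k y"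
proof -
  obtain x0 where x0: "sq_sum k x0 = 1"
    and max: "\<And>y. adj_form k E y \<le> adj_form k E x0 * sq_sum k y"
    using rayleigh_quotient_attains_max[OF k] by blast
  define l where "l = adj_form k E x0"
  define x where "x = (\<lambda>i. \<bar>x0 i\<bar>)"
  have x1: "sq_sum k x = 1" using x0 by (simp add: x_def sq_sum_def)
  have "adj_form k E x = l"
    using max[of x] adj_form_abs_ge[of k E x0] x1 by (simp add: l_def x_def)
  then have eig: "nbr_sum k E x i = l * x i" if "i < k" for i
    using rayleigh_maximizer_eigenvector[of E k l x i] sym max x1 that by (simp add: l_def)
  let ?A = "adjacency_matrix k E"
  have A: "?A \<in> carrier_mat k k" by (simp add: adjacency_matrix_def)
  define v where "v = vec k (\<lambda>i. complex_of_real (x i))"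
  have v: "v \<in> carrier_vec k" by (simp add: v_def)
  have "v \<noteq> 0\<^sub>v k"
  proof
    assume "v = 0\<^sub>v k"
    then have "x i = 0" if "i < k" for i
      using that by (metis v_def index_vec index_zero_vec(1) of_real_eq_0_iff)
    then show False using x1 sq_sum_eq_0_iff[of k x] by auto
  qed
  moreover have "?A *\<^sub>v v = complex_of_real l \<cdot>\<^sub>v v"
  proof (rule eq_vecI)
    fix i assume "i < dim_vec (complex_of_real l \<cdot>\<^sub>v v)"
    then have i: "i < k" by (simp add: v_def)
    have "(?A *\<^sub>v v) $ i = (\<Sum>j = 0..<k. of_bool (E i j) * complex_of_real (x j))"
      unfolding adjacency_matrix_mult_vec[OF i v] by (intro sum.cong) (auto simp: v_def)
    also have "\<dots> = complex_of_real (nbr_sum k E x i)"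
      unfolding nbr_sum_def of_real_sum by (intro sum.cong) auto
    finally show "(?A *\<^sub>v v) $ i = (complex_of_real l \<cdot>\<^sub>v v) $ i"
      using eig[OF i] i by (simp add: v_def)
  qed (simp add: v_def adjacency_matrix_def)
  ultimately have "complex_of_real l \<in> spectrum ?A"
    using v A unfolding spectrum_def eigenvalue_def eigenvector_def by auto
  then have "\<bar>l\<bar> \<le> spectral_radius ?A"
    by (intro spectral_radius_mem_max(2)[OF A k]) (auto intro!: image_eqI[of _ _ "complex_of_real l"])
  then have le: "l \<le> spectral_radius ?A" by simp
  obtain c where c: "c \<in> spectrum ?A" "spectral_radius ?A = norm c"
    using spectral_radius_mem_max(1)[OF A k] by auto
  then obtain w where w: "w \<in> carrier_vec k" "w \<noteq> 0\<^sub>v k" "?A *\<^sub>v w = c \<cdot>\<^sub>v w"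
    using A unfolding spectrum_def eigenvalue_def eigenvector_def by auto
  \<comment> \<open>By the triangle inequality the moduli satisfy
    \<open>norm c * y i \<le> nbr_sum k E y i\<close>.\<close>
  define y where "y = (\<lambda>i. norm (w $ i))"
  have "norm c * sq_sum k y \<le> adj_form k E y"
    unfolding sq_sum_def adj_form_def sum_distrib_left
  proof (intro sum_mono)
    fix i assume "i \<in> {0..<k}"
    then have i: "i < k" by simp
    have "c * w $ i = (\<Sum>j = 0..<k. of_bool (E i j) * w $ j)"
      using adjacency_matrix_mult_vec[OF i w(1), of E] w i by simp
    then have "norm c * y i \<le> (\<Sum>j = 0..<k. norm (of_bool (E i j) * w $ j))"
      unfolding y_def norm_mult[symmetric] by (simp only: norm_sum)
    also have "\<dots> = nbr_sum k E y i"
      unfolding nbr_sum_def y_def by (intro sum.cong) (auto simp: norm_mult)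
    finally show "norm c * (y i)\<^sup>2 \<le> y i * nbr_sum k E y i"
      using mult_left_mono[of "norm c * y i" "nbr_sum k E y i" "y i"]
      by (simp add: y_def power2_eq_square algebra_simps)
  qed
  also have "\<dots> \<le> l * sq_sum k y" using max[of y] by (simp add: l_def)
  finally have "norm c * sq_sum k y \<le> l * sq_sum k y" .
  moreover have "sq_sum k y > 0"
  proof -
    obtain i where "i < k" "w $ i \<noteq> 0"
      using w by (metis carrier_vecD eq_vecI index_zero_vec)
    then show ?thesis by (intro sq_sum_pos[of i]) (auto simp: y_def)
  qed
  ultimately have "graph_spectral_radius k E = l"
    using le c by (simp add: graph_spectral_radius_def)
  then show thesis
    using that[of x] x1 eig max by (simp add: l_def x_def)
qed

lemma adj_form_le_spectral_radius:
  assumes "k > 0" and "\<And>i j. E i j \<Longrightarrow> E j i"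
  shows "adj_form k E y \<le> graph_spectral_radius k E * sq_sum k y"
  by (rule spectral_radius_eq_rayleigh_max[of k E]) (use assms in auto)

lemma adj_form_eigenvector:
  assumes "\<And>i. i < k \<Longrightarrow> nbr_sum k E x i = \<mu> * x i"
  shows "adj_form k E x = \<mu> * sq_sum k x"
  unfolding adj_form_def sq_sum_def sum_distrib_left
  using assms by (intro sum.cong) (auto simp: power2_eq_square)

text \<open>At a zero of a nonnegative eigenvector the neighbour sum vanishes, so all neighbours are
  zeros too; connectedness would spread this to the whole graph.\<close>

lemma perron_vector_exists:
  assumes k: "k > 0" and E: "simple_graph_on k E" and conn: "connected_on E {0..<k}"
  obtains x where "\<And>i. i < k \<Longrightarrow> 0 < x i"
    "\<And>i. i < k \<Longrightarrow> nbr_sum k E x i = graph_spectral_radius k E * x i"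
proof -
  have sym: "E i j \<Longrightarrow> E j i" for i j using E by (auto simp: simple_graph_on_def)
  obtain x where x: "sq_sum k x = 1" "\<And>i. 0 \<le> x i"
    and eig: "\<And>i. i < k \<Longrightarrow> nbr_sum k E x i = graph_spectral_radius k E * x i"
    by (rule spectral_radius_eq_rayleigh_max[of k E]) (use k sym in auto)
  have step: "x b = 0" if "x a = 0" "E a b" for a b
  proof -
    have ab: "a < k" "b < k" using that E by (auto simp: simple_graph_on_def)
    then have "(\<Sum>j = 0..<k. of_bool (E a j) * x j) = 0"
      using eig[of a] that by (simp add: nbr_sum_def)
    then have "\<forall>j\<in>{0..<k}. of_bool (E a j) * x j = 0"
      by (subst (asm) sum_nonneg_eq_0_iff) (auto simp: x)
    then show ?thesis using that ab by auto
  qed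
  have "x i \<noteq> 0" if "i < k" for i
  proof
    assume i0: "x i = 0"
    have "x j = 0" if "j < k" for j
    proof -
      have "(\<lambda>a b. E a b \<and> a \<in> {0..<k} \<and> b \<in> {0..<k})\<^sup>*\<^sup>* i j"
        using conn \<open>i < k\<close> that by (auto simp: connected_on_def)
      then show ?thesis by (induction rule: rtranclp_induct) (auto simp: i0 step)
    qed
    then show False using x sq_sum_eq_0_iff[of k x] by auto
  qed
  then show thesis using that[of x] x eig by (metis less_eq_real_def)
qed

section \<open>Isomorphic graphs and their spectral radii\<close>

lemma graph_iso_sym:
  assumes "graph_iso k E F" shows "graph_iso k F E"
proof -
  obtain f where f: "bij_betw f {0..<k} {0..<k}"
    "\<forall>x\<in>{0..<k}. \<forall>y\<in>{0..<k}. E x y \<longleftrightarrow> F (f x) (f y)"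
    using assms by (auto simp: graph_iso_def)
  let ?g = "inv_into {0..<k} f"
  have "bij_betw ?g {0..<k} {0..<k}" using f(1) by (rule bij_betw_inv_into)
  moreover have "F x y \<longleftrightarrow> E (?g x) (?g y)" if "x \<in> {0..<k}" "y \<in> {0..<k}" for x y
    using f that bij_betw_inv_into_right[OF f(1)] bij_betwE[OF calculation] by metis
  ultimately show ?thesis unfolding graph_iso_def by blast
qed

text \<open>A top eigenvector of \<open>F\<close>, pulled back along the isomorphism, is a test
  vector for \<open>E\<close> with the same Rayleigh quotient.\<close>

lemma graph_iso_spectral_radius_le:
  assumes k: "k > 0" and E: "\<And>i j. E i j \<Longrightarrow> E j i" and F: "\<And>i j. F i j \<Longrightarrow> F j i"
    and iso: "graph_iso k E F"
  shows "graph_spectral_radius k F \<le> graph_spectral_radius k E"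
proof -
  obtain f where f: "bij_betw f {0..<k} {0..<k}"
    "\<And>x y. x \<in> {0..<k} \<Longrightarrow> y \<in> {0..<k} \<Longrightarrow> E x y \<longleftrightarrow> F (f x) (f y)"
    using iso by (auto simp: graph_iso_def)
  obtain x where x: "sq_sum k x = 1"
    "\<And>i. i < k \<Longrightarrow> nbr_sum k F x i = graph_spectral_radius k F * x i"
    by (rule spectral_radius_eq_rayleigh_max[of k F]) (use k F in auto)
  have sum_f: "(\<Sum>i = 0..<k. h (f i)) = (\<Sum>i = 0..<k. h i)" for h :: "nat \<Rightarrow> real"
    using sum.reindex_bij_betw[OF f(1)] .
  have "nbr_sum k E (x \<circ> f) i = nbr_sum k F x (f i)" if "i \<in> {0..<k}" for i
    unfolding nbr_sum_def using sum_f[of "\<lambda>j. of_bool (F (f i) j) * x j"] that f(2)[of i]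
    by (auto intro!: sum.cong)
  then have "adj_form k E (x \<circ> f) = (\<Sum>i = 0..<k. x (f i) * nbr_sum k F x (f i))"
    unfolding adj_form_def by (intro sum.cong) auto
  also have "\<dots> = adj_form k F x" unfolding adj_form_def by (rule sum_f)
  finally have "adj_form k E (x \<circ> f) = graph_spectral_radius k F"
    using adj_form_eigenvector[of k F x] x by simp
  moreover have "sq_sum k (x \<circ> f) = 1"
    using x(1) sum_f[of "\<lambda>i. (x i)\<^sup>2"] by (simp add: sq_sum_def)
  ultimately show ?thesis
    using adj_form_le_spectral_radius[of k E "x \<circ> f"] k E by simp
qed

section \<open>Rooted block graphs\<close>

definition class_size :: "'a set \<Rightarrow> ('a \<Rightarrow> 'b) \<Rightarrow> 'b \<Rightarrow> nat" where
  "class_size A f l = card {v \<in> A. f v = l}"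

text \<open>The cap is 2 because a dissociation set takes at most two vertices from a clique; the
  classes will be cliques.\<close>

definition capped_size_sum :: "nat \<Rightarrow> 'a set \<Rightarrow> ('a \<Rightarrow> nat) \<Rightarrow> nat" where
  "capped_size_sum k A f = (\<Sum>l = 0..<k. min 2 (class_size A f l))"

section \<open>Paths, cycles and blocks\<close>

lemma connected_on_insert:
  assumes S: "connected_on E S" and z: "z \<in> S" "E y z" and sym: "\<And>a b. E a b \<Longrightarrow> E b a"
  shows "connected_on E (insert y S)"
proof -
  let ?R = "\<lambda>a b. E a b \<and> a \<in> insert y S \<and> b \<in> insert y S"
  have S': "?R\<^sup>*\<^sup>* a b" if "a \<in> S" "b \<in> S" for a b
    using S that rtranclp_mono[of "\<lambda>a b. E a b \<and> a \<in> S \<and> b \<in> S" ?R]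
    unfolding connected_on_def by blast
  have yz: "?R\<^sup>*\<^sup>* y z" "?R\<^sup>*\<^sup>* z y" using z sym by (auto intro!: r_into_rtranclp)
  have "?R\<^sup>*\<^sup>* a z \<and> ?R\<^sup>*\<^sup>* z a" if "a \<in> insert y S" for a
    using that S' yz z by auto
  then show ?thesis unfolding connected_on_def by (blast intro: rtranclp_trans)
qed

lemma connected_on_path:
  assumes sym: "\<And>a b. E a b \<Longrightarrow> E b a"
  shows "successively E ys \<Longrightarrow> connected_on E (set ys)"
proof (induction ys)
  case Nil
  then show ?case by (simp add: connected_on_def)
next
  case (Cons y ys)
  show ?case
  proof (cases "ys = []")
    case True
    then show ?thesis by (simp add: connected_on_def)
  next
    case False
    then have "E y (hd ys)" "successively E ys" using Cons.prems by (auto simp: successively_Cons)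
    then show ?thesis
      using connected_on_insert[of E "set ys" "hd ys" y] Cons.IH False sym by simp
  qed
qed

lemma nonseparable_subset_block:
  assumes "S \<noteq> {}" "S \<subseteq> {0..<k}" "nonseparable_on E S"
  obtains T where "is_block k E T" "S \<subseteq> T"
proof -
  let ?F = "{T. T \<subseteq> {0..<k} \<and> nonseparable_on E T}"
  have "finite ?F" by (rule finite_subset[of _ "Pow {0..<k}"]) auto
  moreover have "S \<in> ?F" using assms by blast
  ultimately have "\<exists>T\<in>?F. S \<subseteq> T \<and> (\<forall>T'\<in>?F. T \<subseteq> T' \<longrightarrow> T = T')"
    by (rule finite_has_maximal2)
  then obtain T where T: "T \<subseteq> {0..<k}" "nonseparable_on E T" "S \<subseteq> T"
    and max: "\<forall>T'\<in>?F. T \<subseteq> T' \<longrightarrow> T = T'" by auto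
  have "\<not> nonseparable_on E T'" if "T \<subset> T'" "T' \<subseteq> {0..<k}" for T'
    using max that by auto
  then have "is_block k E T" using T assms(1) unfolding is_block_def by auto
  with T that show thesis by blast
qed

lemma rtrancl_path_successively:
  "rtrancl_path r a xs b \<Longrightarrow> successively r (a # xs) \<and> last (a # xs) = b"
proof (induction rule: rtrancl_path.induct)
  case (step x y ys z)
  then show ?case by (auto simp: successively_Cons)
qed simp

text \<open>Two neighbours of \<open>v\<close> that are joined by a path avoiding \<open>v\<close> lie on a cycle through \<open>v\<close>;
  a cycle is nonseparable, so it sits inside one block.\<close>
lemma block_graph_nbrs_adjacent:
  assumes bg: "block_graph k E" and va: "E v a" and vb: "E v b" and ab: "a \<noteq> b"
    and path: "(\<lambda>x y. E x y \<and> x \<noteq> v \<and> y \<noteq> v)\<^sup>*\<^sup>* a b"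
  shows "E a b"
proof -
  have sym: "\<And>x y. E x y \<Longrightarrow> E y x" and irr: "\<And>x. \<not> E x x"
    and bd: "\<And>x y. E x y \<Longrightarrow> x < k \<and> y < k"
    using bg by (auto simp: block_graph_def simple_graph_on_def)
  let ?R = "\<lambda>x y. E x y \<and> x \<noteq> v \<and> y \<noteq> v"
  obtain xs0 where "rtrancl_path ?R a xs0 b" using path by (auto simp: rtranclp_eq_rtrancl_path)
  \<comment> \<open>Removing repetitions makes the closed walk through \<open>v\<close> a simple
    cycle.\<close>
  then obtain xs where xs: "rtrancl_path ?R a xs b" "distinct (a # xs)"
    by (rule rtrancl_path_distinct)
  define ys where "ys = a # xs"
  have sR: "successively ?R ys" and last: "last ys = b"
    using rtrancl_path_successively[OF xs(1)] by (auto simp: ys_def)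
  have suc: "successively E ys" by (rule successively_mono[OF sR]) auto
  have ys: "ys \<noteq> []" "hd ys = a" "distinct ys" using xs by (auto simp: ys_def)
  \<comment> \<open>Every vertex of \<open>xs\<close> is the target of a step of \<open>?R\<close>,
    hence differs from \<open>v\<close>; the start \<open>a\<close> differs because there are no
    loops.\<close>
  have rng: "Rangep ?R z" if "z \<in> set xs" for z using rtrancl_path_Range[OF xs(1) that] .
  have v: "v \<notin> set ys" and lt: "set ys \<subseteq> {0..<k}"
    using rng va irr bd by (fastforce simp: ys_def elim: Rangep.cases)+
  let ?S = "insert v (set ys)"
  have "connected_on E ?S"
    using connected_on_path[of E "v # ys"] sym suc va ys by (simp add: successively_Cons)
  moreover have "connected_on E (?S - {x})" if "x \<in> ?S" for x
  proof (cases "x = v")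
    case True
    then have "?S - {x} = set ys" using v by auto
    then show ?thesis using connected_on_path[of E ys] sym suc by simp
  next
    case False
    then have "x \<in> set ys" using that by simp
    from split_list[OF this] obtain as bs where split: "ys = as @ x # bs" by blast
    \<comment> \<open>Deleting \<open>x\<close> opens the cycle into a path that starts just after
      \<open>x\<close>, passes through \<open>v\<close> and ends just before
      \<open>x\<close>.\<close>
    have "?S - {x} = set (bs @ v # as)" using split ys(3) v by auto
    moreover have "successively E (bs @ v # as)"
    proof -
      have "successively E as" "successively E bs"
        using suc split by (auto simp: successively_append_iff successively_Cons)
      moreover have "as \<noteq> [] \<Longrightarrow> hd as = a" "bs \<noteq> [] \<Longrightarrow> last bs = b"
        using split ys(2) last by auto
      ultimately show ?thesis
        using va sym[OF vb] by (auto simp: successively_append_iff successively_Cons)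
    qed
    ultimately show ?thesis using connected_on_path[of E "bs @ v # as"] sym by simp
  qed
  ultimately have ns: "nonseparable_on E ?S" by (auto simp: nonseparable_on_def)
  have sub: "?S \<subseteq> {0..<k}" using lt bd[OF va] by auto
  obtain T where T: "is_block k E T" "?S \<subseteq> T"
    by (rule nonseparable_subset_block[OF _ sub ns]) auto
  have "a \<in> ?S" "b \<in> ?S" using ys(1,2) last by (auto simp: ys_def split: if_splits)
  then show ?thesis using T ab bg unfolding block_graph_def by blast
qed

section \<open>Levels, parents and sibling classes\<close>

locale rooted_block_graph =
  fixes k :: nat and E :: "nat \<Rightarrow> nat \<Rightarrow> bool" and u :: nat
  assumes bg: "block_graph k E" and root: "u < k"
begin

definition lev :: "nat \<Rightarrow> nat" where
  "lev v = (LEAST n. (E ^^ n) u v)"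

text \<open>The choice is forced: a vertex other than the root has exactly one neighbour one level
  closer to the root (\<open>parent_unique\<close>).\<close>

definition parent :: "nat \<Rightarrow> nat" where
  "parent v = (SOME w. E w v \<and> lev v = Suc (lev w))"

text \<open>For \<open>v\<close> other than the root this is the block through \<open>v\<close> and
  its parent, with the parent removed.\<close>

definition siblings :: "nat \<Rightarrow> nat set" where
  "siblings v = {w. w = v \<or> (E v w \<and> lev v = lev w)}"

text \<open>The least member names the class, so that labels of vertices are again numbers below
  \<open>k\<close>.\<close>

definition label :: "nat \<Rightarrow> nat" where
  "label v = Min (siblings v)"

lemma sym: "E x y \<Longrightarrow> E y x" and irrefl: "\<not> E x x"
  and bounds: "E x y \<Longrightarrow> x < k" "E x y \<Longrightarrow> y < k"
  using bg by (auto simp: block_graph_def simple_graph_on_def)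

lemma reachable: "v < k \<Longrightarrow> E\<^sup>*\<^sup>* u v"
proof -
  assume "v < k"
  then have "(\<lambda>a b. E a b \<and> a \<in> {0..<k} \<and> b \<in> {0..<k})\<^sup>*\<^sup>* u v"
    using bg root by (auto simp: block_graph_def connected_on_def)
  then show ?thesis by (rule rtranclp_mono[THEN predicate2D, rotated]) auto
qed

lemma lev_relpowp: "v < k \<Longrightarrow> (E ^^ lev v) u v"
  unfolding lev_def using rtranclp_imp_relpowp[OF reachable] by (rule LeastI_ex)

lemma lev_root: "lev u = 0"
  unfolding lev_def by (rule Least_eq_0) simp

lemma lev_eq_0: "v < k \<Longrightarrow> lev v = 0 \<longleftrightarrow> v = u"
  using lev_relpowp[of v] lev_root by auto

lemma lev_edge: "E a b \<Longrightarrow> lev b \<le> Suc (lev a)"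
  unfolding lev_def[of b] using lev_relpowp[of a] bounds[of a b]
  by (intro Least_le) (auto intro: relpowp_Suc_I)

lemma parent_exists:
  assumes "v < k" "v \<noteq> u"
  shows "\<exists>w. E w v \<and> lev v = Suc (lev w)"
proof -
  obtain m where m: "lev v = Suc m" using assms lev_eq_0[of v] by (cases "lev v") auto
  then have "(E ^^ Suc m) u v" using lev_relpowp[OF assms(1)] by metis
  then obtain w where w: "(E ^^ m) u w" "E w v" by (rule relpowp_Suc_E)
  have "lev w \<le> m" unfolding lev_def by (rule Least_le) (rule w)
  then show ?thesis using w m lev_edge[OF w(2)] by auto
qed

lemma parent:
  assumes "v < k" "v \<noteq> u"
  shows "E (parent v) v" "lev v = Suc (lev (parent v))"
  using someI_ex[OF parent_exists[OF assms]] unfolding parent_def by auto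

text \<open>Climb along parents: levels fall strictly, so after the start all vertices lie below the
  level of \<open>v\<close>.\<close>

lemma path_to_root_avoiding:
  assumes "v \<noteq> u"
  shows "x < k \<Longrightarrow> x \<noteq> v \<Longrightarrow> lev x \<le> lev v \<Longrightarrow>
    (\<lambda>a b. E a b \<and> a \<noteq> v \<and> b \<noteq> v)\<^sup>*\<^sup>* x u"
proof (induction "lev x" arbitrary: x rule: less_induct)
  case less
  show ?case
  proof (cases "x = u")
    case False
    note p = parent[OF less.prems(1) False]
    then have "parent x \<noteq> v" using less.prems by auto
    then have "(\<lambda>a b. E a b \<and> a \<noteq> v \<and> b \<noteq> v)\<^sup>*\<^sup>* (parent x) u"
      using less p bounds[OF p(1)] by auto
    moreover have "E x (parent x) \<and> x \<noteq> v \<and> parent x \<noteq> v"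
      using p sym less.prems \<open>parent x \<noteq> v\<close> by auto
    ultimately show ?thesis by (intro converse_rtranclp_into_rtranclp[of _ x "parent x" u])
  qed simp
qed

text \<open>Both neighbours reach the root without meeting \<open>v\<close>, so they are joined by a
  path avoiding \<open>v\<close>.\<close>

lemma lower_nbrs_adjacent:
  assumes "E v a" "E v b" "a \<noteq> b" "lev a \<le> lev v" "lev b \<le> lev v" "v \<noteq> u"
  shows "E a b"
proof -
  let ?R = "\<lambda>a b. E a b \<and> a \<noteq> v \<and> b \<noteq> v"
  have "a \<noteq> v" "b \<noteq> v" using assms irrefl by auto
  then have "?R\<^sup>*\<^sup>* a u" "?R\<^sup>*\<^sup>* b u"
    using path_to_root_avoiding[OF assms(6)] assms bounds by blast+
  moreover have "symp ?R\<^sup>*\<^sup>*" by (rule symp_rtranclp) (auto intro: sympI sym)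
  ultimately have "?R\<^sup>*\<^sup>* a b" by (meson rtranclp_trans sympD)
  then show ?thesis using block_graph_nbrs_adjacent[OF bg assms(1-3)] by blast
qed

text \<open>Two parents \<open>w\<close> and \<open>b\<close> of \<open>v\<close> would be adjacent,
  then \<open>parent w\<close> would be adjacent to \<open>b\<close>, and the path from
  \<open>parent w\<close> over \<open>b\<close> to \<open>v\<close> avoids \<open>w\<close>. This
  makes \<open>parent w\<close> adjacent to \<open>v\<close>, two levels further down.\<close>

lemma parent_unique:
  assumes w: "E w v" "lev v = Suc (lev w)"
  shows "w = parent v"
proof (rule ccontr)
  assume ne: "w \<noteq> parent v"
  define b where "b = parent v"
  have v: "v < k" "v \<noteq> u" using w bounds lev_root by auto
  have b: "E b v" "lev b = lev w" "b < k" using parent[OF v] w bounds by (auto simp: b_def)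
  have wb: "E w b"
    using lower_nbrs_adjacent[of v w b] sym w b ne v by (auto simp: b_def)
  have wk: "w < k" using w bounds by blast
  \<comment> \<open>Otherwise \<open>w\<close> and \<open>b\<close> would both have level 0, that
    is, both be the root.\<close>
  have "w \<noteq> u"
    using b lev_eq_0[OF wk] lev_eq_0[OF b(3)] ne by (auto simp: b_def)
  note q = parent[OF wk this]
  have qb: "E (parent w) b"
    using lower_nbrs_adjacent[of w "parent w" b] q sym wb b \<open>w \<noteq> u\<close>
    by (metis lessI less_irrefl order_le_less)
  let ?R = "\<lambda>x y. E x y \<and> x \<noteq> w \<and> y \<noteq> w"
  have ne': "parent w \<noteq> w" "b \<noteq> w" "v \<noteq> w" using q ne irrefl w by (auto simp: b_def)
  then have "?R (parent w) b" "?R b v" using qb b by auto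
  then have "?R\<^sup>*\<^sup>* (parent w) v" by (rule converse_rtranclp_into_rtranclp[where r = ?R, OF _ r_into_rtranclp[where r = ?R]])
  then have "E (parent w) v"
    using block_graph_nbrs_adjacent[OF bg, of w "parent w" v] q sym w by force
  then show False using lev_edge[of "parent w" v] q w by auto
qed

lemma not_root_if_same_lev: "E v w \<Longrightarrow> lev v = lev w \<Longrightarrow> v \<noteq> u"
  using lev_eq_0[of w] bounds[of v w] irrefl[of u] lev_root by auto

text \<open>\<open>parent v\<close> and \<open>w\<close> are neighbours of \<open>v\<close> at
  levels no larger than its own, hence adjacent, and \<open>w\<close> has only one parent.\<close>

lemma parent_eq_if_same_lev:
  assumes "E v w" "lev v = lev w"
  shows "parent v = parent w"
proof -
  have v: "v < k" "v \<noteq> u" using assms not_root_if_same_lev bounds by auto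
  note p = parent[OF v]
  have "E (parent v) w"
    using lower_nbrs_adjacent[of v "parent v" w] p sym assms v
    by (metis lessI less_irrefl order_le_less)
  then show ?thesis using parent_unique[of "parent v" w] p assms by simp
qed

text \<open>Same-level adjacency is transitive: two neighbours of \<open>b\<close> on its own level
  fall under \<open>lower_nbrs_adjacent\<close>. So the sibling sets are equivalence
  classes.\<close>

lemma siblings_eq:
  assumes "w \<in> siblings v" shows "siblings w = siblings v"
proof -
  have sub: "siblings b \<subseteq> siblings a" if "b \<in> siblings a" for a b :: nat
  proof
    fix z assume z: "z \<in> siblings b"
    show "z \<in> siblings a"
    proof (cases "b = a \<or> z = b \<or> z = a")
      case True
      then show ?thesis using that z by (auto simp: siblings_def)
    next
      case False
      then have "E b a" "E b z" "lev b = lev a" "lev z = lev b" "a \<noteq> z"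
        using that z sym by (auto simp: siblings_def)
      then have "E a z"
        using lower_nbrs_adjacent[of b a z] not_root_if_same_lev[of b a] by auto
      then show ?thesis using \<open>lev b = lev a\<close> \<open>lev z = lev b\<close> by (auto simp: siblings_def)
    qed
  qed
  have "v \<in> siblings w" using assms sym by (auto simp: siblings_def)
  then show ?thesis using sub[of v w] sub[of w v] assms by blast
qed

lemma label_in_siblings: "v < k \<Longrightarrow> label v \<in> siblings v"
proof -
  have "siblings v \<subseteq> insert v {0..<k}" using bounds[of v] by (auto simp: siblings_def)
  then have "finite (siblings v)" by (rule finite_subset) simp
  then show ?thesis unfolding label_def by (intro Min_in) (auto simp: siblings_def)
qed

lemma label_eq_iff:
  assumes "v < k" "w < k"
  shows "label v = label w \<longleftrightarrow> v = w \<or> (E v w \<and> lev v = lev w)"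
proof
  assume "label v = label w"
  then have "siblings v = siblings w"
    using siblings_eq[OF label_in_siblings[OF assms(1)]] siblings_eq[OF label_in_siblings[OF assms(2)]]
    by simp
  then have "w \<in> siblings v" by (auto simp: siblings_def)
  then show "v = w \<or> (E v w \<and> lev v = lev w)" by (auto simp: siblings_def)
next
  assume "v = w \<or> (E v w \<and> lev v = lev w)"
  then have "w \<in> siblings v" by (auto simp: siblings_def)
  then show "label v = label w" unfolding label_def using siblings_eq[of w v] by simp
qed

lemma label_less: "v < k \<Longrightarrow> label v < k"
  using label_in_siblings[of v] bounds(2)[of v "label v"] by (auto simp: siblings_def)

text \<open>Levels along an edge differ by at most one, so every edge either joins a vertex to its
  parent or lies inside a class. This is the form in which \<open>adj_form_rooted\<close> takes a
  graph.\<close>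

lemma edge_iff:
  assumes "i < k" "j < k"
  shows "E i j \<longleftrightarrow> (j \<noteq> u \<and> i = parent j) \<or> (i \<noteq> u \<and> j = parent i) \<or>
    (i \<noteq> u \<and> j \<noteq> u \<and> i \<noteq> j \<and> label i = label j)"
proof
  assume e: "E i j"
  have "lev i \<le> Suc (lev j)" "lev j \<le> Suc (lev i)" using lev_edge[OF e] lev_edge[OF sym[OF e]] by auto
  then consider "lev i = lev j" | "lev i = Suc (lev j)" | "lev j = Suc (lev i)" by linarith
  then show "(j \<noteq> u \<and> i = parent j) \<or> (i \<noteq> u \<and> j = parent i) \<or>
    (i \<noteq> u \<and> j \<noteq> u \<and> i \<noteq> j \<and> label i = label j)"
  proof cases
    case 1
    then show ?thesis
      using not_root_if_same_lev[of i j] not_root_if_same_lev[of j i] e sym[OF e] irrefl[of i]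
        label_eq_iff[OF assms] by auto
  next
    case 2
    then show ?thesis using parent_unique[of j i] sym[OF e] lev_root by auto
  next
    case 3
    then show ?thesis using parent_unique[of i j] e lev_root by auto
  qed
next
  assume "(j \<noteq> u \<and> i = parent j) \<or> (i \<noteq> u \<and> j = parent i) \<or>
    (i \<noteq> u \<and> j \<noteq> u \<and> i \<noteq> j \<and> label i = label j)"
  then show "E i j"
    using parent(1)[of i] parent(1)[of j] assms sym[of j i] label_eq_iff[OF assms] by auto
qed

lemma label_neq_parent: "v < k \<Longrightarrow> v \<noteq> u \<Longrightarrow> label (parent v) \<noteq> label v"
  using parent[of v] bounds[of "parent v" v] label_eq_iff[of "parent v" v] by auto

lemma parent_less: "v < k \<Longrightarrow> v \<noteq> u \<Longrightarrow> parent v < k"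
  using parent(1)[of v] bounds(1)[of "parent v" v] by blast

section \<open>Dissociation sets and sibling classes\<close>

lemma dissociation_set_class_le:
  assumes D: "dissociation_set k E D"
  shows "card {v \<in> D - {u}. label v = l} \<le> min 2 (class_size ({0..<k} - {u}) label l)"
proof -
  have Dk: "D \<subseteq> {0..<k}" and deg: "\<And>x. x \<in> D \<Longrightarrow> card {y \<in> D. E x y} \<le> 1"
    using D by (auto simp: dissociation_set_def)
  have fD: "finite D" using Dk finite_subset by blast
  let ?P = "{v \<in> D - {u}. label v = l}"
  have fP: "finite ?P" using fD by simp
  have "card ?P \<le> class_size ({0..<k} - {u}) label l"
    unfolding class_size_def using Dk by (intro card_mono) auto
  moreover have "card ?P \<le> 2"
  proof (cases "?P = {}")
    case False
    then obtain x where x: "x \<in> ?P" by blast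
    \<comment> \<open>The class is a clique, so its other members in \<open>D\<close> are neighbours
      of \<open>x\<close>, of which \<open>D\<close> admits at most one.\<close>
    have "?P - {x} \<subseteq> {y \<in> D. E x y}"
    proof
      fix y assume "y \<in> ?P - {x}"
      moreover from this have "x < k" "y < k" using x Dk by auto
      ultimately show "y \<in> {y \<in> D. E x y}" using x label_eq_iff[of x y] by auto
    qed
    then have "card (?P - {x}) \<le> card {y \<in> D. E x y}" using fD by (intro card_mono) auto
    also have "\<dots> \<le> 1" using deg x by blast
    finally show ?thesis using x fP by (simp add: card_Diff_singleton)
  next
    case True
    then show ?thesis by (metis card.empty zero_le)
  qed
  ultimately show ?thesis by simp
qed

lemma dissociation_set_card:
  assumes "D \<subseteq> {0..<k}"
  shows "card (D - {u}) = (\<Sum>l = 0..<k. card {v \<in> D - {u}. label v = l})"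
proof -
  have "finite (D - {u})" using assms finite_subset by blast
  then have "(\<Sum>l = 0..<k. \<Sum>v\<in>{v \<in> D - {u}. label v = l}. 1) = (\<Sum>v\<in>D - {u}. 1::nat)"
    using assms label_less by (intro sum.group) auto
  then show ?thesis by simp
qed

lemma dissociation_le_capped:
  assumes D: "dissociation_set k E D"
  shows "card (D - {u}) \<le> capped_size_sum k ({0..<k} - {u}) label"
  using D dissociation_set_card[of D] dissociation_set_class_le[OF D]
  by (simp add: capped_size_sum_def sum_mono dissociation_set_def)

lemma root_nbr_exists:
  assumes "k \<ge> 2" obtains v where "E u v"
proof -
  define w where "w = (if u = 0 then 1 else 0 :: nat)"
  have w: "w < k" "w \<noteq> u" using assms by (auto simp: w_def)
  from reachable[OF w(1)] show thesis
    by (rule converse_rtranclpE) (use w that in auto)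
qed

text \<open>Without its root \<open>D\<close> respects the capped bound, so an excess means that
  \<open>D\<close> contains \<open>u\<close> and fills every class to its cap. This forces all
  neighbours of \<open>u\<close> into \<open>D\<close>, where \<open>u\<close> may have only one:
  the root is a leaf.\<close>

lemma root_leaf_if_dissociation_exceeds:
  assumes k: "k \<ge> 2" and D: "dissociation_set k E D"
    and gt: "card D > capped_size_sum k ({0..<k} - {u}) label"
  obtains v where "\<And>w. E u w \<longleftrightarrow> w = v"
proof -
  let ?A = "{0..<k} - {u}"
  let ?c = "\<lambda>l. card {v \<in> D - {u}. label v = l}"
  have Dk: "D \<subseteq> {0..<k}" and deg: "\<And>x. x \<in> D \<Longrightarrow> card {y \<in> D. E x y} \<le> 1"
    using D by (auto simp: dissociation_set_def)
  have fD: "finite D" using Dk finite_subset by blast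
  have uD: "u \<in> D"
    using dissociation_le_capped[OF D] gt by (cases "u \<in> D") auto
  then have "card (D - {u}) \<ge> capped_size_sum k ?A label" using gt fD by (simp add: card_Diff_singleton)
  then have "(\<Sum>l = 0..<k. min 2 (class_size ?A label l)) \<le> (\<Sum>l = 0..<k. ?c l)"
    using dissociation_set_card[OF Dk] by (simp add: capped_size_sum_def)
  \<comment> \<open>Sums compared termwise in one direction and in total in the other agree
    termwise.\<close>
  then have eq: "?c l = min 2 (class_size ?A label l)" if "l < k" for l
    using sum_mono_inv[of ?c "{0..<k}" "\<lambda>l. min 2 (class_size ?A label l)" l]
      dissociation_set_class_le[OF D] that
      sum_mono[of "{0..<k}" ?c "\<lambda>l. min 2 (class_size ?A label l)"] by fastforce
  have nbr: "v \<in> D" if v: "E u v" for v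
  proof -
    let ?P = "{w \<in> D - {u}. label w = label v}"
    let ?Q = "{w \<in> ?A. label w = label v}"
    have vk: "v < k" "v \<noteq> u" using v bounds[OF v] irrefl[of u] by auto
    have pv: "parent v = u"
      using parent_unique[OF v] lev_edge[OF v] lev_eq_0[of v] vk lev_root by force
    \<comment> \<open>Siblings of a child of the root are children of the root.\<close>
    have "?P \<subseteq> {y \<in> D. E u y}"
    proof
      fix w assume w: "w \<in> ?P"
      then have wk: "w < k" "w \<noteq> u" using Dk by auto
      then have "parent w = u"
        using label_eq_iff[OF vk(1) wk(1)] w parent_eq_if_same_lev[of v w] pv by auto
      then show "w \<in> {y \<in> D. E u y}" using parent(1)[OF wk] w by auto
    qed
    then have "card ?P \<le> card {y \<in> D. E u y}" using fD by (intro card_mono) auto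
    then have "card ?P \<le> 1" using deg[OF uD] by simp
    moreover have "card ?P = min 2 (card ?Q)"
      using eq[OF label_less[OF vk(1)]] by (simp add: class_size_def)
    moreover have "v \<in> ?Q" using vk by simp
    then have "card ?Q \<ge> 1" 
      by (intro Suc_leI[of 0, unfolded One_nat_def[symmetric]]) (auto simp: card_gt_0_iff)
    \<comment> \<open>Since the minimum with 2 is at most 1, it is the class size itself, so
      \<open>D\<close> contains the whole class of \<open>v\<close>.\<close>
    ultimately have "card ?P = card ?Q" by linarith
    moreover have "?P \<subseteq> ?Q" using Dk by auto
    ultimately have "?P = ?Q" by (intro card_subset_eq) auto
    then show ?thesis using \<open>v \<in> ?Q\<close> by blast
  qed
  obtain v where v: "E u v" using root_nbr_exists[OF k] .
  have "w = v" if "E u w" for w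
  proof -
    have "{v, w} \<subseteq> {y \<in> D. E u y}" using nbr v that by auto
    then have "card {v, w} \<le> card {y \<in> D. E u y}" using fD by (intro card_mono) auto
    then have "card {v, w} \<le> 1" using deg[OF uD] by simp
    then show ?thesis by (cases "v = w") auto
  qed
  then show thesis using that v by blast
qed

end

section \<open>Labellings with a bound on capped class sizes\<close>

definition class_weight :: "('a \<Rightarrow> real) \<Rightarrow> 'a set \<Rightarrow> ('a \<Rightarrow> 'b) \<Rightarrow> 'b \<Rightarrow> real" where
  "class_weight x A f l = (\<Sum>v\<in>{v \<in> A. f v = l}. x v)"

text \<open>Equals the sum of \<open>x i * x j\<close> over ordered pairs within a class, the only
  part of the adjacency form of a fan that depends on the partition.\<close>

definition weight_sq_sum :: "nat \<Rightarrow> ('a \<Rightarrow> real) \<Rightarrow> 'a set \<Rightarrow> ('a \<Rightarrow> nat) \<Rightarrow> real" where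
  "weight_sq_sum k x A f = (\<Sum>l = 0..<k. (class_weight x A f l)\<^sup>2)"

text \<open>The pattern of the blocks of \<open>B_graph\<close> without the centre: pairs, except
  for at most one singleton and at most one larger class.\<close>

definition extremal_shape :: "nat \<Rightarrow> nat \<Rightarrow> 'a set \<Rightarrow> ('a \<Rightarrow> nat) \<Rightarrow> bool" where
  "extremal_shape \<phi> k A f \<longleftrightarrow> capped_size_sum k A f = \<phi> \<and>
     (\<forall>a<k. \<forall>b<k. class_size A f a = 1 \<and> class_size A f b = 1 \<longrightarrow> a = b) \<and>
     (\<forall>a<k. \<forall>b<k. 3 \<le> class_size A f a \<and> 3 \<le> class_size A f b \<longrightarrow> a = b)"

lemma class_size_cong: "(\<And>v. v \<in> A \<Longrightarrow> f v = g v) \<Longrightarrow> class_size A f l = class_size A g l"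
  unfolding class_size_def by (rule arg_cong[of _ _ card]) auto

lemma capped_size_sum_cong:
  "(\<And>v. v \<in> A \<Longrightarrow> f v = g v) \<Longrightarrow> capped_size_sum k A f = capped_size_sum k A g"
  unfolding capped_size_sum_def using class_size_cong[of A f g] by simp

lemma weight_sq_sum_cong:
  assumes "\<And>v. v \<in> A \<Longrightarrow> f v = g v"
  shows "weight_sq_sum k x A f = weight_sq_sum k x A g"
proof -
  have "{v \<in> A. f v = l} = {v \<in> A. g v = l}" for l using assms by auto
  then show ?thesis unfolding weight_sq_sum_def class_weight_def by simp
qed

section \<open>Moving one vertex to another class\<close>

lemma sum_split_two:
  fixes h :: "'a \<Rightarrow> 'b::comm_monoid_add"
  assumes "finite L" "a \<in> L" "b \<in> L" "a \<noteq> b"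
  shows "sum h L = h a + h b + sum h (L - {a, b})"
proof -
  have "L = {a, b} \<union> (L - {a, b})" using assms by auto
  then have "sum h L = sum h {a, b} + sum h (L - {a, b})"
    using assms by (metis Diff_disjoint finite_Diff finite.emptyI finite.insertI sum.union_disjoint)
  then show ?thesis using assms by simp
qed

lemma move_vertex:
  fixes f :: "'a \<Rightarrow> 'b"
  assumes A: "finite A" and p: "p \<in> A" "f p = a" and ab: "a \<noteq> b"
  shows "class_size A f a = Suc (class_size A (f(p := b)) a)"
    "class_size A (f(p := b)) b = Suc (class_size A f b)"
    "\<And>l. l \<noteq> a \<Longrightarrow> l \<noteq> b \<Longrightarrow> class_size A (f(p := b)) l = class_size A f l"
    "class_weight x A (f(p := b)) a = class_weight x A f a - x p"
    "class_weight x A (f(p := b)) b = class_weight x A f b + x p"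
    "\<And>l. l \<noteq> a \<Longrightarrow> l \<noteq> b \<Longrightarrow> class_weight x A (f(p := b)) l = class_weight x A f l"
proof -
  let ?f = "f(p := b)"
  have a: "{v \<in> A. f v = a} = insert p {v \<in> A. ?f v = a}" and na: "p \<notin> {v \<in> A. ?f v = a}"
    using p ab by auto
  have b: "{v \<in> A. ?f v = b} = insert p {v \<in> A. f v = b}" and nb: "p \<notin> {v \<in> A. f v = b}"
    using p ab by auto
  have l: "{v \<in> A. ?f v = l} = {v \<in> A. f v = l}" if "l \<noteq> a" "l \<noteq> b" for l
    using p that by auto
  show "class_size A f a = Suc (class_size A ?f a)"
    unfolding class_size_def a using na A by (subst card_insert_disjoint) auto
  show "class_size A ?f b = Suc (class_size A f b)"
    unfolding class_size_def b using nb A by (subst card_insert_disjoint) auto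
  show "class_size A ?f l = class_size A f l" if "l \<noteq> a" "l \<noteq> b" for l
    unfolding class_size_def l[OF that] ..
  show "class_weight x A ?f a = class_weight x A f a - x p"
    unfolding class_weight_def a using na A by (subst sum.insert) auto
  show "class_weight x A ?f b = class_weight x A f b + x p"
    unfolding class_weight_def b using nb A by (subst sum.insert) auto
  show "class_weight x A ?f l = class_weight x A f l" if "l \<noteq> a" "l \<noteq> b" for l
    unfolding class_weight_def l[OF that] ..
qed

text \<open>With class weights \<open>S\<close> and \<open>T\<close> of the old and new class, the
  sum of squares grows by \<open>2 * x p * (T - S + x p)\<close>.\<close>

lemma move_to_heavier_class:
  assumes A: "finite A" and p: "p \<in> A" "f p = a" and ab: "a \<noteq> b" "a < k" "b < k"
    and xp: "x p > 0" and le: "class_weight x A f a \<le> class_weight x A f b"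
  shows "weight_sq_sum k x A f < weight_sq_sum k x A (f(p := b))"
proof -
  let ?f = "f(p := b)"
  note m = move_vertex[where f = f, OF A p ab(1)]
  let ?r = "\<Sum>l\<in>{0..<k} - {a, b}. (class_weight x A f l)\<^sup>2"
  have "weight_sq_sum k x A f = (class_weight x A f a)\<^sup>2 + (class_weight x A f b)\<^sup>2 + ?r"
    unfolding weight_sq_sum_def using ab by (intro sum_split_two) auto
  moreover have "weight_sq_sum k x A ?f = (class_weight x A ?f a)\<^sup>2 + (class_weight x A ?f b)\<^sup>2
      + (\<Sum>l\<in>{0..<k} - {a, b}. (class_weight x A ?f l)\<^sup>2)"
    unfolding weight_sq_sum_def using ab by (intro sum_split_two) auto
  moreover have "(\<Sum>l\<in>{0..<k} - {a, b}. (class_weight x A ?f l)\<^sup>2) = ?r"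
    using m(6)[of _ x] by (intro sum.cong) auto
  ultimately have "weight_sq_sum k x A ?f - weight_sq_sum k x A f =
      2 * x p * (class_weight x A f b - class_weight x A f a + x p)"
    using m(4)[of x] m(5)[of x] by (simp add: power2_eq_square algebra_simps)
  moreover have "0 < 2 * x p * (class_weight x A f b - class_weight x A f a + x p)"
    using xp le by simp
  ultimately show ?thesis by linarith
qed

text \<open>Stated additively to avoid truncated subtraction; the remaining
  \<open>class_size A f a - 1\<close> is exact because \<open>p\<close> lies in class
  \<open>a\<close>.\<close>

lemma capped_size_sum_move:
  assumes A: "finite A" and p: "p \<in> A" "f p = a" and ab: "a \<noteq> b" "a < k" "b < k"
  shows "capped_size_sum k A (f(p := b)) + min 2 (class_size A f a) + min 2 (class_size A f b) =
    capped_size_sum k A f + min 2 (class_size A f a - 1) + min 2 (Suc (class_size A f b))"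
proof -
  let ?f = "f(p := b)"
  note m = move_vertex[where f = f, OF A p ab(1)]
  let ?r = "\<Sum>l\<in>{0..<k} - {a, b}. min 2 (class_size A f l)"
  have "capped_size_sum k A f = min 2 (class_size A f a) + min 2 (class_size A f b) + ?r"
    unfolding capped_size_sum_def using ab by (intro sum_split_two) auto
  moreover have "capped_size_sum k A ?f = min 2 (class_size A ?f a) + min 2 (class_size A ?f b)
      + (\<Sum>l\<in>{0..<k} - {a, b}. min 2 (class_size A ?f l))"
    unfolding capped_size_sum_def using ab by (intro sum_split_two) auto
  moreover have "(\<Sum>l\<in>{0..<k} - {a, b}. min 2 (class_size A ?f l)) = ?r"
    using m(3) by (intro sum.cong) auto
  ultimately show ?thesis using m(1,2) by simp
qed

text \<open>Moving a vertex to a class of at least the same weight strictly increases the sum of squares,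
  so at a maximiser every such move must violate the constraint on the capped class sizes.\<close>
lemma maximizer_extremal_shape:
  fixes f :: "'a \<Rightarrow> nat"
  assumes A: "finite A" and x: "\<And>v. v \<in> A \<Longrightarrow> x v > 0" and \<phi>: "\<phi> \<ge> 2"
    and f: "f ` A \<subseteq> {0..<k}" "capped_size_sum k A f \<ge> \<phi>"
    and max: "\<And>g. g ` A \<subseteq> {0..<k} \<Longrightarrow> capped_size_sum k A g \<ge> \<phi> \<Longrightarrow>
      weight_sq_sum k x A g \<le> weight_sq_sum k x A f"
  shows "extremal_shape \<phi> k A f"
proof -
  let ?c = "class_size A f"
  \<comment> \<open>The alternatives in \<open>big\<close> are situations where the move respects
    the bound: slack absorbs a loss of at most one, two classes of size at least 3 keep their caps,
    and two singletons merge into a pair.\<close>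
  have key: False
    if ab: "a < k" "b < k" "a \<noteq> b" "?c a \<ge> 1" "?c b \<ge> 1"
      and le: "class_weight x A f a \<le> class_weight x A f b"
      and big: "capped_size_sum k A f > \<phi> \<or> (?c a \<ge> 3 \<and> ?c b \<ge> 3) \<or> (?c a = 1 \<and> ?c b = 1)" for a b
  proof -
    have "{v \<in> A. f v = a} \<noteq> {}" using ab(4) by (metis card.empty class_size_def not_one_le_zero)
    then obtain p where p: "p \<in> A" "f p = a" by blast
    let ?f = "f(p := b)"
    have "weight_sq_sum k x A f < weight_sq_sum k x A ?f"
      using move_to_heavier_class[where f = f, OF A p ab(3,1,2) _ le] x p by blast
    moreover have "?f ` A \<subseteq> {0..<k}" using f ab by auto
    moreover have "capped_size_sum k A ?f \<ge> \<phi>"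
      using capped_size_sum_move[where f = f, OF A p ab(3,1,2)] big f(2) ab(4,5)
      by (auto simp: min_def split: if_splits)
    ultimately show False using max[of ?f] by linarith
  qed
  \<comment> \<open>One of the two classes is at most as heavy as the other, so the weight condition
    goes by symmetry.\<close>
  have key': False
    if "a < k" "b < k" "a \<noteq> b" "?c a \<ge> 1" "?c b \<ge> 1"
      "capped_size_sum k A f > \<phi> \<or> (?c a \<ge> 3 \<and> ?c b \<ge> 3) \<or> (?c a = 1 \<and> ?c b = 1)" for a b
    using key[of a b] key[of b a] that by linarith
  have "capped_size_sum k A f = \<phi>"
  proof (rule ccontr)
    assume "capped_size_sum k A f \<noteq> \<phi>"
    then have gt: "capped_size_sum k A f > \<phi>" using f by linarith
    then have "\<exists>a<k. ?c a \<ge> 1"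
      by (rule_tac ccontr) (auto simp: capped_size_sum_def not_le)
    then obtain a where a: "a < k" "?c a \<ge> 1" by blast
    \<comment> \<open>With slack only one class can be nonempty, and its capped size is at most
      \<open>2 \<le> \<phi>\<close>.\<close>
    have "?c b = 0" if "b < k" "b \<noteq> a" for b
      using key'[of a b] gt a that by (cases "?c b = 0") auto
    then have "capped_size_sum k A f = (\<Sum>l = 0..<k. if l = a then min 2 (?c a) else 0)"
      unfolding capped_size_sum_def by (intro sum.cong) auto
    also have "\<dots> \<le> 2" using a by simp
    finally show False using gt \<phi> by simp
  qed
  moreover have "a = b" if "a < k" "b < k" "?c a = 1" "?c b = 1" for a b
    using key'[of a b] that by auto
  moreover have "a = b" if "a < k" "b < k" "3 \<le> ?c a" "3 \<le> ?c b" for a b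
    using key'[of a b] that by (cases "a = b") auto
  ultimately show ?thesis unfolding extremal_shape_def by blast
qed

text \<open>Only the values on \<open>A\<close> matter, so the maximum is taken over the finitely
  many labellings restricted to \<open>A\<close>.\<close>

lemma maximizer_exists:
  fixes f :: "'a \<Rightarrow> nat"
  assumes A: "finite A" and f: "f ` A \<subseteq> {0..<k}" "capped_size_sum k A f \<ge> \<phi>"
  obtains g where "g ` A \<subseteq> {0..<k}" "capped_size_sum k A g \<ge> \<phi>"
    "\<And>h. h ` A \<subseteq> {0..<k} \<Longrightarrow> capped_size_sum k A h \<ge> \<phi> \<Longrightarrow>
      weight_sq_sum k x A h \<le> weight_sq_sum k x A g"
proof -
  let ?P = "{g \<in> PiE A (\<lambda>_. {0..<k}). capped_size_sum k A g \<ge> \<phi>}"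
  have inP: "restrict h A \<in> ?P" if "h ` A \<subseteq> {0..<k}" "capped_size_sum k A h \<ge> \<phi>" for h
    using that capped_size_sum_cong[of A "restrict h A" h k] by auto
  have fin: "finite ?P" using A by (auto intro!: finite_PiE)
  have ne: "?P \<noteq> {}" using inP[OF f] by blast
  let ?W = "weight_sq_sum k x A ` ?P"
  have "Max ?W \<in> ?W" using fin ne by (intro Max_in) auto
  then obtain g where gP: "g \<in> ?P" and gW: "weight_sq_sum k x A g = Max ?W" by auto
  have gmax: "weight_sq_sum k x A h \<le> weight_sq_sum k x A g" if "h \<in> ?P" for h
    unfolding gW using fin that by (intro Max_ge) auto
  show thesis
  proof (rule that[of g])
    show "g ` A \<subseteq> {0..<k}" "capped_size_sum k A g \<ge> \<phi>" using gP by auto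
    fix h :: "'a \<Rightarrow> nat" assume h: "h ` A \<subseteq> {0..<k}" "capped_size_sum k A h \<ge> \<phi>"
    show "weight_sq_sum k x A h \<le> weight_sq_sum k x A g"
      using gmax[OF inP[OF h]] weight_sq_sum_cong[of A "restrict h A" h k x] by simp
  qed
qed

section \<open>Uniqueness of the extremal partition\<close>

lemma sum_class_size:
  fixes f :: "'a \<Rightarrow> nat"
  assumes "finite A" "f ` A \<subseteq> {0..<k}"
  shows "(\<Sum>l = 0..<k. class_size A f l) = card A"
proof -
  have "(\<Sum>l = 0..<k. \<Sum>v\<in>{v \<in> A. f v = l}. 1) = (\<Sum>v\<in>A. 1::nat)"
    using assms by (intro sum.group) auto
  then show ?thesis by (simp add: class_size_def)
qed

lemma capped_size_sum_le_card:
  "finite A \<Longrightarrow> f ` A \<subseteq> {0..<k} \<Longrightarrow> capped_size_sum k A f \<le> card A"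
  unfolding capped_size_sum_def sum_class_size[symmetric] by (intro sum_mono) auto

lemma at_most_one_element:
  assumes "\<And>a b. a \<in> S \<Longrightarrow> b \<in> S \<Longrightarrow> a = b"
  shows "S = {} \<or> (\<exists>a. S = {a})" and "card S \<le> 1"
proof -
  show *: "S = {} \<or> (\<exists>a. S = {a})" using assms by blast
  then show "card S \<le> 1" by (elim disjE exE) simp_all
qed

text \<open>The two parameters \<open>\<phi>\<close> and \<open>card A\<close> fix the shape: the
  singleton is decided by the parity of \<open>\<phi>\<close>, there are \<open>\<phi> div 2\<close>
  classes of size at least 2, and a larger class, if present, absorbs the whole excess
  \<open>card A - \<phi>\<close>.\<close>

lemma extremal_shape_class_counts:
  assumes A: "finite A" "f ` A \<subseteq> {0..<k}" and ext: "extremal_shape \<phi> k A f" and n: "n \<ge> 1"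
  shows "card {l. l < k \<and> class_size A f l = n} =
    (if n = 1 then \<phi> mod 2
     else if n = 2 then (if card A = \<phi> then \<phi> div 2 else \<phi> div 2 - 1)
     else of_bool (n + \<phi> = card A + 2))"
proof -
  let ?c = "class_size A f"
  let ?N = "\<lambda>P. card {l. l < k \<and> P (?c l)}"
  have cap: "(\<Sum>l = 0..<k. min 2 (?c l)) = \<phi>"
    using ext by (simp add: extremal_shape_def capped_size_sum_def)
  have cnt: "(\<Sum>l = 0..<k. of_bool (P (?c l))) = ?N P" for P
  proof -
    have "{0..<k} \<inter> {l. P (?c l)} = {l. l < k \<and> P (?c l)}" by auto
    then show ?thesis by simp
  qed
  have "(\<Sum>l = 0..<k. min 2 (?c l)) = (\<Sum>l = 0..<k. of_bool (?c l = 1) + 2 * of_bool (?c l \<ge> 2))"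
    by (intro sum.cong) auto
  then have \<phi>: "\<phi> = ?N (\<lambda>c. c = 1) + 2 * ?N (\<lambda>c. c \<ge> 2)"
    by (simp only: cap sum.distrib sum_distrib_left[symmetric] cnt[of "\<lambda>c. c = 1"]
        cnt[of "\<lambda>c. c \<ge> 2"])
  have N2: "?N (\<lambda>c. c \<ge> 2) = ?N (\<lambda>c. c = 2) + ?N (\<lambda>c. c \<ge> 3)"
    unfolding cnt[of "\<lambda>c. c \<ge> 2", symmetric] cnt[of "\<lambda>c. c = 2", symmetric]
      cnt[of "\<lambda>c. c \<ge> 3", symmetric] sum.distrib[symmetric] by (intro sum.cong) auto
  have N1: "?N (\<lambda>c. c = 1) \<le> 1"
    by (rule at_most_one_element(2)) (use ext in \<open>auto simp: extremal_shape_def\<close>)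
  have md: "a = m mod 2 \<and> b = m div 2" if "a \<le> 1" "m = a + 2 * b" for a b m :: nat
    using that by presburger
  note md = md[OF N1 \<phi>]
  have N2': "?N (\<lambda>c. c = 2) = \<phi> div 2 - ?N (\<lambda>c. c \<ge> 3)" using md N2 by linarith
  \<comment> \<open>The counts for sizes 1 and 2 follow from the number of classes of size at least
    3; the two cases below supply the rest.\<close>
  have goal: ?thesis
    if N3: "?N (\<lambda>c. c \<ge> 3) = of_bool (card A \<noteq> \<phi>)"
      and n3: "n \<ge> 3 \<Longrightarrow> card {l. l < k \<and> ?c l = n} = of_bool (n + \<phi> = card A + 2)"
  proof -
    consider "n = 1" | "n = 2" | "n \<ge> 3" using n by linarith
    then show ?thesis
    proof cases
      case 1
      show ?thesis unfolding 1 using md by simp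
    next
      case 2
      show ?thesis unfolding 2 N2' N3 by simp
    next
      case 3
      then show ?thesis using n3 by simp
    qed
  qed
  \<comment> \<open>Each size is its capped part plus its truncated excess over 2; the excesses add
    up to \<open>card A - \<phi>\<close>.\<close>
  have "card A = (\<Sum>l = 0..<k. min 2 (?c l) + (?c l - 2))"
    unfolding sum_class_size[OF A, symmetric] by (intro sum.cong) auto
  then have cA: "card A = \<phi> + (\<Sum>l = 0..<k. ?c l - 2)" by (simp add: sum.distrib cap)
  have three: "{l. l < k \<and> ?c l \<ge> 3} = {} \<or> (\<exists>a. {l. l < k \<and> ?c l \<ge> 3} = {a})"
    by (rule at_most_one_element(1)) (use ext in \<open>auto simp: extremal_shape_def\<close>)
  then show ?thesis
  proof
    assume e: "{l. l < k \<and> ?c l \<ge> 3} = {}"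
    have small: "?c l \<le> 2" if "l < k" for l 
    proof (rule ccontr)
      assume "\<not> ?c l \<le> 2"
      then have "l \<in> {l. l < k \<and> ?c l \<ge> 3}" using that by simp
      then show False unfolding e by simp
    qed
    then have "(\<Sum>l = 0..<k. ?c l - 2) = 0" by simp
    then have cA': "card A = \<phi>" using cA by simp
    have "{l. l < k \<and> ?c l = n} = {}" if "n \<ge> 3" using small that by fastforce
    then have n0: "card {l. l < k \<and> ?c l = n} = 0" if "n \<ge> 3" using that by (metis card.empty)
    show ?thesis by (rule goal) (use n0 e cA' in simp_all)
  next
    assume "\<exists>a. {l. l < k \<and> ?c l \<ge> 3} = {a}"
    then obtain a where a: "{l. l < k \<and> ?c l \<ge> 3} = {a}" by blast
    then have ak: "a < k" "?c a \<ge> 3" by auto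
    have other: "?c l \<le> 2" if "l < k" "l \<noteq> a" for l
    proof (rule ccontr)
      assume "\<not> ?c l \<le> 2"
      then have "l \<in> {l. l < k \<and> ?c l \<ge> 3}" using that by simp
      then show False using that unfolding a by simp
    qed
    have "(\<Sum>l = 0..<k. ?c l - 2) = (\<Sum>l = 0..<k. if l = a then ?c a - 2 else 0)"
      using other by (intro sum.cong) auto
    then have cA': "card A = \<phi> + (?c a - 2)" using cA ak by simp
    have N3: "?N (\<lambda>c. c \<ge> 3) = 1" using a by simp
    have "card {l. l < k \<and> ?c l = n} = of_bool (n = ?c a)" if n3: "n \<ge> 3"
    proof -
      have "{l. l < k \<and> ?c l = n} = (if n = ?c a then {a} else {})"
      proof -
        have "l < k \<and> ?c l = n \<longleftrightarrow> n = ?c a \<and> l = a" for l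
          using other[of l] n3 ak(1) by (cases "l = a") auto
        then show ?thesis by simp
      qed
      then show ?thesis by simp
    qed
    moreover have "n = ?c a \<longleftrightarrow> n + \<phi> = card A + 2" using cA' ak by auto
    moreover have "card A \<noteq> \<phi>" using cA' ak by simp
    ultimately show ?thesis using N3 by (intro goal) simp_all
  qed
qed

text \<open>Bijections between fibers of equal size glue together, since fibers over different
  values are disjoint.\<close>

lemma bij_betw_matching_fibers:
  fixes F :: "'a \<Rightarrow> 'c" and H :: "'b \<Rightarrow> 'c"
  assumes "finite A" "finite B"
    and eq: "\<And>c. card {a \<in> A. F a = c} = card {b \<in> B. H b = c}"
  obtains h where "bij_betw h A B" "\<And>a. a \<in> A \<Longrightarrow> H (h a) = F a"
proof -
  have "\<exists>h. bij_betw h {a \<in> A. F a = c} {b \<in> B. H b = c}" for c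
    using assms by (intro finite_same_card_bij) auto
  then obtain hh where hh: "\<And>c. bij_betw (hh c) {a \<in> A. F a = c} {b \<in> B. H b = c}" by metis
  define h where "h = (\<lambda>a. hh (F a) a)"
  have img: "h a \<in> B \<and> H (h a) = F a" if "a \<in> A" for a
    using bij_betwE[OF hh[of "F a"]] that by (auto simp: h_def)
  have "inj_on h A"
  proof (rule inj_onI)
    fix a a' assume *: "a \<in> A" "a' \<in> A" "h a = h a'"
    then have "F a = F a'" using img by metis
    then show "a = a'" using * hh[of "F a"] by (auto simp: h_def bij_betw_def inj_on_def)
  qed
  moreover have "B \<subseteq> h ` A"
  proof
    fix b assume "b \<in> B"
    then have "b \<in> hh (H b) ` {a \<in> A. F a = H b}"
      using hh[of "H b"] by (auto simp: bij_betw_def)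
    then obtain a where "a \<in> A" "b = h a" by (auto simp: h_def)
    then show "b \<in> h ` A" by blast
  qed
  ultimately show thesis using that[of h] img by (auto simp: bij_betw_def)
qed

text \<open>Fibers are matched twice: first occurring labels by class size, then vertices by matched
  label.\<close>

lemma extremal_shape_bij:
  fixes f :: "'a \<Rightarrow> nat" and g :: "'b \<Rightarrow> nat"
  assumes A: "finite A" "f ` A \<subseteq> {0..<k}" "extremal_shape \<phi> k A f"
    and B: "finite B" "g ` B \<subseteq> {0..<k}" "extremal_shape \<phi> k B g"
    and card: "card A = card B"
  obtains h where "bij_betw h A B"
    "\<And>x y. x \<in> A \<Longrightarrow> y \<in> A \<Longrightarrow> f x = f y \<longleftrightarrow> g (h x) = g (h y)"
proof -
  have fin: "finite (f ` A)" "finite (g ` B)" using A B by auto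
  \<comment> \<open>Labels in the image have nonempty classes, so the count for size 0 is empty and
    \<open>extremal_shape_class_counts\<close> covers the other sizes.\<close>
  have img: "{l \<in> f ` A. class_size A f l = n} =
      (if n = 0 then {} else {l. l < k \<and> class_size A f l = n})"
    if "finite A" "f ` A \<subseteq> {0..<k}" for A :: "'c set" and f :: "'c \<Rightarrow> nat" and n
  proof -
    have "l \<in> f ` A \<longleftrightarrow> class_size A f l \<noteq> 0" for l
      using that by (auto simp: class_size_def)
    moreover have "l < k" if "l \<in> f ` A" for l
      using that \<open>f ` A \<subseteq> {0..<k}\<close> by auto
    ultimately show ?thesis by auto
  qed
  have "card {l \<in> f ` A. class_size A f l = n} = card {l \<in> g ` B. class_size B g l = n}" for n
    unfolding img[OF A(1,2)] img[OF B(1,2)]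
    using extremal_shape_class_counts[OF A, of n] extremal_shape_class_counts[OF B, of n] card
    by auto
  from bij_betw_matching_fibers[OF fin this] obtain \<pi> where
    \<pi>: "bij_betw \<pi> (f ` A) (g ` B)" and size: "\<And>l. l \<in> f ` A \<Longrightarrow> class_size B g (\<pi> l) = class_size A f l"
    by metis
  have "card {a \<in> A. \<pi> (f a) = c} = card {b \<in> B. g b = c}" for c
  proof (cases "c \<in> g ` B")
    case True
    then have "c \<in> \<pi> ` (f ` A)" using bij_betw_imp_surj_on[OF \<pi>] by simp
    then obtain l where l: "l \<in> f ` A" "c = \<pi> l" by blast
    then have "{a \<in> A. \<pi> (f a) = c} = {a \<in> A. f a = l}"
      using \<pi> by (auto simp: bij_betw_def inj_on_def)
    then show ?thesis using size[OF l(1)] l by (simp add: class_size_def)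
  next
    case False
    then have "{a \<in> A. \<pi> (f a) = c} = {}" "{b \<in> B. g b = c} = {}"
      using bij_betwE[OF \<pi>] by auto
    then show ?thesis by (metis card.empty)
  qed
  from bij_betw_matching_fibers[OF A(1) B(1) this] obtain h where
    h: "bij_betw h A B" "\<And>a. a \<in> A \<Longrightarrow> g (h a) = \<pi> (f a)" by metis
  have "f x = f y \<longleftrightarrow> g (h x) = g (h y)" if "x \<in> A" "y \<in> A" for x y
    using h(2) that \<pi> by (auto simp: bij_betw_def inj_on_def)
  then show thesis using that h(1) by blast
qed

section \<open>Fans\<close>

text \<open>A cone with apex \<open>u\<close> over disjoint cliques, the classes of \<open>f\<close>
  away from \<open>u\<close>.\<close>

definition fan :: "nat \<Rightarrow> nat \<Rightarrow> (nat \<Rightarrow> 'b) \<Rightarrow> nat \<Rightarrow> nat \<Rightarrow> bool" where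
  "fan k u f x y \<longleftrightarrow> x < k \<and> y < k \<and> x \<noteq> y \<and> (x = u \<or> y = u \<or> f x = f y)"

lemma fan_sym: "fan k u f x y \<Longrightarrow> fan k u f y x"
  by (auto simp: fan_def)

lemma B_graph_eq_fan: "B_graph k \<phi> = fan k 0 (B_label \<phi>)"
  by (intro ext) (simp add: B_graph_def fan_def)

text \<open>A block stays connected without \<open>u\<close>, and edges away from \<open>u\<close>
  preserve the label, so the rest of the block lies in one class.\<close>

lemma fan_block_graph:
  assumes u: "u < k"
  shows "block_graph k (fan k u f)"
proof -
  let ?F = "fan k u f"
  have "simple_graph_on k ?F" by (auto simp: simple_graph_on_def fan_def)
  moreover have "connected_on ?F {0..<k}"
  proof -
    let ?R = "\<lambda>a b. ?F a b \<and> a \<in> {0..<k} \<and> b \<in> {0..<k}"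
    have "?R\<^sup>*\<^sup>* x u \<and> ?R\<^sup>*\<^sup>* u x" if "x < k" for x
    proof (cases "x = u")
      case False
      then have "?R x u" "?R u x" using u that by (auto simp: fan_def)
      then show ?thesis by (metis (no_types, lifting) r_into_rtranclp)
    qed simp
    then show ?thesis
      unfolding connected_on_def by (meson atLeastLessThan_iff rtranclp_trans)
  qed
  moreover have "?F x y" if S: "is_block k ?F S" and xy: "x \<in> S" "y \<in> S" "x \<noteq> y" for S x y
  proof (rule ccontr)
    assume n: "\<not> ?F x y"
    have Sk: "S \<subseteq> {0..<k}" using S by (auto simp: is_block_def)
    then have xu: "x \<noteq> u" "y \<noteq> u" "f x \<noteq> f y" using n xy by (auto simp: fan_def)
    have "connected_on ?F (S - {u})"
      using S by (cases "u \<in> S") (auto simp: is_block_def nonseparable_on_def)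
    then have "(\<lambda>a b. ?F a b \<and> a \<in> S - {u} \<and> b \<in> S - {u})\<^sup>*\<^sup>* x y"
      using xy xu by (auto simp: connected_on_def)
    then have "f y = f x" by (induction rule: rtranclp_induct) (auto simp: fan_def)
    then show False using xu by simp
  qed
  ultimately show ?thesis by (simp add: block_graph_def)
qed

text \<open>If \<open>D\<close> contains the centre, all its other vertices are neighbours of
  \<open>u\<close>, so it has at most 2 elements; otherwise it takes at most two vertices from each
  class.\<close>

lemma fan_dissociation_card_le:
  assumes f: "f ` ({0..<k} - {u}) \<subseteq> {0..<k}" and D: "dissociation_set k (fan k u f) D"
  shows "card D \<le> max 2 (capped_size_sum k ({0..<k} - {u}) f)"
proof -
  let ?F = "fan k u f" and ?A = "{0..<k} - {u}"
  have Dk: "D \<subseteq> {0..<k}" and deg: "\<And>x. x \<in> D \<Longrightarrow> card {y \<in> D. ?F x y} \<le> 1"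
    using D by (auto simp: dissociation_set_def)
  have fD: "finite D" using Dk finite_subset by blast
  have clique: "card P \<le> 2" if P: "P \<subseteq> D" "\<And>x y. x \<in> P \<Longrightarrow> y \<in> P \<Longrightarrow> x \<noteq> y \<Longrightarrow> ?F x y"
      and "x \<in> P" for P x
  proof -
    have "P - {x} \<subseteq> {y \<in> D. ?F x y}" using P \<open>x \<in> P\<close> by auto
    then have "card (P - {x}) \<le> card {y \<in> D. ?F x y}" using fD by (intro card_mono) auto
    also have "\<dots> \<le> 1" using deg P \<open>x \<in> P\<close> by blast
    finally show ?thesis using \<open>x \<in> P\<close> finite_subset[OF P(1) fD] by (simp add: card_Diff_singleton)
  qed
  show ?thesis
  proof (cases "u \<in> D")
    case True
    have "D - {u} \<subseteq> {y \<in> D. ?F u y}" using True Dk by (auto simp: fan_def)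
    then have "card (D - {u}) \<le> card {y \<in> D. ?F u y}" using fD by (intro card_mono) auto
    also have "\<dots> \<le> 1" using deg True by blast
    finally show ?thesis using True fD by (simp add: card_Diff_singleton)
  next
    case False
    then have DA: "D \<subseteq> ?A" using Dk by auto
    have "card {v \<in> D. f v = l} \<le> min 2 (class_size ?A f l)" for l
    proof -
      let ?P = "{v \<in> D. f v = l}"
      have "card ?P \<le> class_size ?A f l"
        unfolding class_size_def using DA by (intro card_mono) auto
      moreover have "card ?P \<le> 2"
      proof (cases "?P = {}")
        case True
        then show ?thesis by (metis card.empty zero_le)
      next
        case False
        then obtain x where x: "x \<in> ?P" by blast
        show ?thesis by (rule clique[OF _ _ x]) (use Dk in \<open>auto simp: fan_def\<close>)
      qed
      ultimately show ?thesis by simp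
    qed
    then have "(\<Sum>l = 0..<k. card {v \<in> D. f v = l}) \<le> capped_size_sum k ?A f"
      unfolding capped_size_sum_def by (intro sum_mono)
    moreover have "(\<Sum>l = 0..<k. class_size D f l) = card D"
      using f DA fD by (intro sum_class_size) auto
    ultimately show ?thesis by (simp add: class_size_def)
  qed
qed

lemma fan_dissociation_set_exists:
  assumes f: "f ` ({0..<k} - {u}) \<subseteq> {0..<k}"
  obtains D where "dissociation_set k (fan k u f) D"
    "card D = capped_size_sum k ({0..<k} - {u}) f"
proof -
  let ?A = "{0..<k} - {u}"
  \<comment> \<open>The set is assembled from two vertices of each class, or all of them if the
    class is smaller.\<close>
  have "\<exists>T. T \<subseteq> {v \<in> ?A. f v = l} \<and> card T = min 2 (class_size ?A f l)" for l
  proof -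
    have "min 2 (class_size ?A f l) \<le> card {v \<in> ?A. f v = l}" by (simp add: class_size_def)
    then obtain S where "S \<subseteq> {v \<in> ?A. f v = l}" "card S = min 2 (class_size ?A f l)"
      by (rule obtain_subset_with_card_n)
    then show ?thesis by blast
  qed
  then obtain T where T: "\<And>l. T l \<subseteq> {v \<in> ?A. f v = l}" "\<And>l. card (T l) = min 2 (class_size ?A f l)"
    by metis
  have Tf: "f v = l" if "v \<in> T l" for v l using T(1) that by blast
  have fT: "finite (T l)" for l using T(1)[of l] by (rule finite_subset) simp
  define D where "D = (\<Union>l\<in>{0..<k}. T l)"
  have fD: "finite D" using fT by (simp add: D_def)
  have DA: "D \<subseteq> ?A" using T(1) by (fastforce simp: D_def)
  have "card D = (\<Sum>l = 0..<k. card (T l))"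
    unfolding D_def
  proof (rule card_UN_disjoint)
    show "\<forall>i\<in>{0..<k}. \<forall>j\<in>{0..<k}. i \<noteq> j \<longrightarrow> T i \<inter> T j = {}"
      using Tf by (metis disjoint_iff)
  qed (use fT in auto)
  then have "card D = capped_size_sum k ?A f" by (simp add: T(2) capped_size_sum_def)
  moreover have "card {y \<in> D. fan k u f x y} \<le> 1" if x: "x \<in> D" for x
  proof -
    have DT: "y \<in> T (f y)" if yD: "y \<in> D" for y
    proof -
      obtain l where "y \<in> T l" using yD unfolding D_def by blast
      then show ?thesis using Tf[of y l] by simp
    qed
    have "{y \<in> D. fan k u f x y} \<subseteq> T (f x) - {x}"
    proof
      fix y assume "y \<in> {y \<in> D. fan k u f x y}"
      then have "y \<in> D" "y \<noteq> x" "f y = f x" using x DA by (auto simp: fan_def)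
      then show "y \<in> T (f x) - {x}" using DT[of y] by simp
    qed
    then have "card {y \<in> D. fan k u f x y} \<le> card (T (f x) - {x})"
      using fT by (intro card_mono) auto
    also have "\<dots> \<le> 1" using DT[OF x] fT T(2)[of "f x"] by (simp add: card_Diff_singleton)
    finally show ?thesis .
  qed
  then have "dissociation_set k (fan k u f) D" using DA by (auto simp: dissociation_set_def)
  ultimately show thesis using that by blast
qed

lemma finite_dissociation_sets: "finite {D. dissociation_set k E D}"
  by (rule finite_subset[of _ "Pow {0..<k}"]) (auto simp: dissociation_set_def)

lemma fan_dissociation_number:
  assumes f: "f ` ({0..<k} - {u}) \<subseteq> {0..<k}" and ge: "capped_size_sum k ({0..<k} - {u}) f \<ge> 2"
  shows "dissociation_number k (fan k u f) = capped_size_sum k ({0..<k} - {u}) f"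
  unfolding dissociation_number_def
proof (rule Max_eqI)
  show "finite (card ` {D. dissociation_set k (fan k u f) D})"
    by (intro finite_imageI finite_dissociation_sets)
  show "y \<le> capped_size_sum k ({0..<k} - {u}) f"
    if "y \<in> card ` {D. dissociation_set k (fan k u f) D}" for y
    using that fan_dissociation_card_le[OF f] ge by fastforce
  show "capped_size_sum k ({0..<k} - {u}) f \<in> card ` {D. dissociation_set k (fan k u f) D}"
    by (rule fan_dissociation_set_exists[OF f]) (auto intro: image_eqI[OF sym])
qed

section \<open>The extremal graph as a fan\<close>

lemma B_label_shape:
  assumes \<phi>: "\<phi> \<ge> 2" and k: "\<phi> < k"
  shows "B_label \<phi> ` ({0..<k} - {0}) \<subseteq> {0..<k}"
    and "extremal_shape \<phi> k ({0..<k} - {0}) (B_label \<phi>)"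
proof -
  define s where "s = \<phi> mod 2"
  define m where "m = (\<phi> - 2 - s) div 2"
  let ?A = "{0..<k} - {0}"
  have s: "s \<le> 1" by (simp add: s_def)
  have \<phi>eq: "\<phi> = s + 2 * m + 2"
  proof -
    have d: "\<phi> = 2 * (\<phi> div 2) + s" "\<phi> div 2 \<ge> 1" using \<phi> by (auto simp: s_def)
    then have "\<phi> - 2 - s = 2 * (\<phi> div 2 - 1)" by linarith
    then have "m = \<phi> div 2 - 1" by (simp add: m_def)
    then show ?thesis using d by linarith
  qed
  have lab: "B_label \<phi> i = (if i \<le> s then 0 else if i \<le> s + 2 * m then s + (i - s - 1) div 2 else s + m)" for i
    unfolding B_label_def Let_def s_def[symmetric] m_def[symmetric] ..
  have sk: "s + 2 * m + 2 < k" using k \<phi>eq by simp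
  show img: "B_label \<phi> ` ?A \<subseteq> {0..<k}" using sk by (auto simp: lab)
  \<comment> \<open>Labels below \<open>s\<close> name the singleton, the next \<open>m\<close>
    labels the pairs, and \<open>s + m\<close> the large clique. For \<open>s = 0\<close> only the
    centre satisfies \<open>i \<le> s\<close>, so no singleton arises.\<close>
  have c1: "{v \<in> ?A. B_label \<phi> v = l} = {1}" if "l < s" for l
    using that s sk by (auto simp: lab)
  have c2: "{v \<in> ?A. B_label \<phi> v = l} = {s + 2 * (l - s) + 1, s + 2 * (l - s) + 2}"
    if "s \<le> l" "l < s + m" for l
    using that s sk by (auto simp: lab split: if_splits)
  have c3: "{v \<in> ?A. B_label \<phi> v = s + m} = {s + 2 * m + 1..<k}"
    using s sk by (auto simp: lab split: if_splits)
  have c4: "{v \<in> ?A. B_label \<phi> v = l} = {}" if "s + m < l" for l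
    using that s sk by (auto simp: lab split: if_splits)
  have size: "class_size ?A (B_label \<phi>) l =
      (if l < s then 1 else if l < s + m then 2 else if l = s + m then k - \<phi> + 1 else 0)" for l
  proof -
    consider "l < s" | "s \<le> l" "l < s + m" | "l = s + m" | "s + m < l" by linarith
    then show ?thesis
    proof cases
      case 1
      then show ?thesis unfolding class_size_def c1[OF 1] by simp
    next
      case 2
      then show ?thesis unfolding class_size_def c2[OF 2] by simp
    next
      case 3
      show ?thesis unfolding 3 class_size_def c3 using k \<phi>eq by simp
    next
      case 4
      then show ?thesis unfolding class_size_def c4[OF 4] by simp
    qed
  qed
  \<comment> \<open>The last class has \<open>k - \<phi> + 1\<close> vertices, at least 2 as
    \<open>\<phi> < k\<close>; so \<open>s\<close> classes count 1 and \<open>m + 1\<close> classes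
    count 2.\<close>
  have "capped_size_sum k ?A (B_label \<phi>) = (\<Sum>l = 0..<s + m + 1. if l < s then 1 else 2)"
    unfolding capped_size_sum_def
    by (rule sum.mono_neutral_cong_right) (use k sk in \<open>auto simp: size\<close>)
  also have "\<dots> = (\<Sum>l = 0..<s. if l < s then 1 else 2) + (\<Sum>l = s..<s + m + 1. if l < s then 1 else 2)"
    by (rule sum.atLeastLessThan_concat[symmetric]) auto
  also have "\<dots> = \<phi>" using \<phi>eq by simp
  finally show "extremal_shape \<phi> k ?A (B_label \<phi>)"
    unfolding extremal_shape_def using s k by (auto simp: size split: if_splits)
qed

lemma B_graph_in_Bl:
  assumes "\<phi> \<ge> 2" and "\<phi> < k"
  shows "B_graph k \<phi> \<in> Bl k \<phi>"
proof -
  note B = B_label_shape[OF assms]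
  have "capped_size_sum k ({0..<k} - {0}) (B_label \<phi>) = \<phi>"
    using B(2) by (simp add: extremal_shape_def)
  then show ?thesis
    using fan_dissociation_number[OF B(1)] fan_block_graph[of 0 k "B_label \<phi>"] assms
    by (simp add: Bl_def B_graph_eq_fan)
qed

text \<open>The class-respecting bijection of the non-central vertices is extended by sending the
  centre \<open>u\<close> to 0.\<close>

lemma fan_iso_B_graph:
  assumes u: "u < k" and \<phi>: "\<phi> \<ge> 2" "\<phi> < k"
    and f: "f ` ({0..<k} - {u}) \<subseteq> {0..<k}" "extremal_shape \<phi> k ({0..<k} - {u}) f"
  shows "graph_iso k (fan k u f) (B_graph k \<phi>)"
proof -
  let ?A = "{0..<k} - {u}" and ?B = "{0..<k} - {0::nat}" and ?g = "B_label \<phi>"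
  have "card ?A = card ?B" using u by (simp add: card_Diff_singleton)
  then obtain h where h: "bij_betw h ?A ?B"
    "\<And>x y. x \<in> ?A \<Longrightarrow> y \<in> ?A \<Longrightarrow> f x = f y \<longleftrightarrow> ?g (h x) = ?g (h y)"
    by (rule extremal_shape_bij[OF finite_Diff[OF finite_atLeastLessThan] f
          finite_Diff[OF finite_atLeastLessThan] B_label_shape[OF \<phi>]]) blast
  define h' where "h' = h(u := 0)"
  have hA: "h' x = h x" if "x \<in> ?A" for x using that by (simp add: h'_def)
  have "bij_betw h' ?A ?B" using h(1) bij_betw_cong[of ?A h' h ?B] hA by simp
  moreover have "bij_betw h' {u} {0}" by (simp add: h'_def)
  ultimately have "bij_betw h' (?A \<union> {u}) (?B \<union> {0})" by (rule bij_betw_combine) auto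
  moreover have "?A \<union> {u} = {0..<k}" "?B \<union> {0} = {0..<k}" using u by auto
  ultimately have bij: "bij_betw h' {0..<k} {0..<k}" by simp
  have "fan k u f x y \<longleftrightarrow> fan k 0 ?g (h' x) (h' y)" if xy: "x < k" "y < k" for x y
  proof -
    have lt: "h' x < k" "h' y < k" using bij_betwE[OF bij] xy by auto
    have eq: "h' a = h' b \<longleftrightarrow> a = b" if "a < k" "b < k" for a b
      using bij that by (auto simp: bij_betw_def inj_on_def)
    have u0: "h' u = 0" by (simp add: h'_def)
    have zero: "h' x = 0 \<longleftrightarrow> x = u" "h' y = 0 \<longleftrightarrow> y = u"
      using eq[OF xy(1) u] eq[OF xy(2) u] u0 by auto
    show ?thesis
    proof (cases "x = u \<or> y = u")
      case True
      then show ?thesis using xy lt eq[OF xy] zero by (auto simp: fan_def)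
    next
      case False
      then have "x \<in> ?A" "y \<in> ?A" using xy by auto
      then have "f x = f y \<longleftrightarrow> ?g (h' x) = ?g (h' y)" using h(2) hA by simp
      then show ?thesis using xy lt eq[OF xy] zero by (auto simp: fan_def)
    qed
  qed
  then show ?thesis unfolding graph_iso_def B_graph_eq_fan using bij by auto
qed

section \<open>The adjacency form through parents and classes\<close>

lemma weight_sq_sum_eq_pair_sum:
  assumes A: "finite A" "f ` A \<subseteq> {0..<k}"
  shows "weight_sq_sum k x A f = (\<Sum>i\<in>A. \<Sum>j\<in>A. of_bool (f i = f j) * (x i * x j))"
proof -
  have "(\<Sum>i\<in>A. x i * class_weight x A f (f i)) =
      (\<Sum>l = 0..<k. \<Sum>i\<in>{i \<in> A. f i = l}. x i * class_weight x A f (f i))"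
    using A by (intro sum.group[symmetric]) auto
  also have "\<dots> = (\<Sum>l = 0..<k. class_weight x A f l * class_weight x A f l)"
  proof (rule sum.cong[OF refl])
    fix l
    have "(\<Sum>i\<in>{i \<in> A. f i = l}. x i * class_weight x A f (f i)) =
        (\<Sum>i\<in>{i \<in> A. f i = l}. x i * class_weight x A f l)" by (intro sum.cong) auto
    then show "(\<Sum>i\<in>{i \<in> A. f i = l}. x i * class_weight x A f (f i)) =
        class_weight x A f l * class_weight x A f l"
      by (simp add: sum_distrib_right class_weight_def[of x A f l])
  qed
  finally have "weight_sq_sum k x A f = (\<Sum>i\<in>A. x i * class_weight x A f (f i))"
    by (simp add: weight_sq_sum_def power2_eq_square)
  also have "\<dots> = (\<Sum>i\<in>A. \<Sum>j\<in>A. of_bool (f i = f j) * (x i * x j))"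
  proof (rule sum.cong[OF refl])
    fix i
    have "class_weight x A f (f i) = (\<Sum>j\<in>A. of_bool (f i = f j) * x j)"
      unfolding class_weight_def using A(1) by (intro sum.mono_neutral_cong_left) auto
    then show "x i * class_weight x A f (f i) = (\<Sum>j\<in>A. of_bool (f i = f j) * (x i * x j))"
      by (simp add: sum_distrib_left mult.left_commute)
  qed
  finally show ?thesis .
qed

lemma sum_remove_vertex:
  fixes g :: "nat \<Rightarrow> real"
  shows "(\<Sum>i = 0..<k. of_bool (i \<noteq> u) * g i) = (\<Sum>i\<in>{0..<k} - {u}. g i)"
  by (rule sum.mono_neutral_cong_right) auto

text \<open>For a block graph rooted at \<open>u\<close> the classes are the blocks
  without their vertex closest to the root; for a fan \<open>p\<close> is constantly \<open>u\<close>.\<close>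
lemma adj_form_rooted:
  assumes f: "f ` ({0..<k} - {u}) \<subseteq> {0..<k}"
    and E: "\<And>i j. i < k \<Longrightarrow> j < k \<Longrightarrow> E i j \<longleftrightarrow> (j \<noteq> u \<and> i = p j) \<or> (i \<noteq> u \<and> j = p i) \<or>
      (i \<noteq> u \<and> j \<noteq> u \<and> i \<noteq> j \<and> f i = f j)"
    and p: "\<And>v. v < k \<Longrightarrow> v \<noteq> u \<Longrightarrow> p v < k"
    and p_cl: "\<And>v. v < k \<Longrightarrow> v \<noteq> u \<Longrightarrow> p v \<noteq> u \<Longrightarrow> f (p v) \<noteq> f v"
    and p_pp: "\<And>v. v < k \<Longrightarrow> v \<noteq> u \<Longrightarrow> p v \<noteq> u \<Longrightarrow> p (p v) \<noteq> v"
  shows "adj_form k E x = 2 * (\<Sum>v\<in>{0..<k} - {u}. x (p v) * x v)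
    + weight_sq_sum k x ({0..<k} - {u}) f - (\<Sum>v\<in>{0..<k} - {u}. (x v)\<^sup>2)"
proof -
  let ?A = "{0..<k} - {u}"
  \<comment> \<open>\<open>?t1\<close> and \<open>?t2\<close> are the parent edges in their two
    orientations, \<open>?t3\<close> the pairs within a class including the diagonal, and
    \<open>?t4\<close> the diagonal to be removed.\<close>
  let ?t1 = "\<lambda>i j. of_bool (j \<noteq> u) * (of_bool (i = p j) * (x i * x j))"
  let ?t2 = "\<lambda>i j. of_bool (i \<noteq> u) * (of_bool (j = p i) * (x i * x j))"
  let ?t3 = "\<lambda>i j. of_bool (i \<noteq> u) * (of_bool (j \<noteq> u) * (of_bool (f i = f j) * (x i * x j)))"
  let ?t4 = "\<lambda>i j. of_bool (i \<noteq> u) * (of_bool (j = i) * (x i * x j))"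
  have split: "x i * (of_bool (E i j) * x j) = ?t1 i j + ?t2 i j + ?t3 i j - ?t4 i j"
    if ij: "i < k" "j < k" for i j
  proof -
    \<comment> \<open>The kinds of edges exclude each other, so the indicator of their union is the
      sum of their indicators.\<close>
    have 1: "\<not> (i = p j \<and> j \<noteq> u \<and> i \<noteq> u \<and> j = p i)" using p_pp[of j] ij by auto
    have 2: "\<not> (i = p j \<and> j \<noteq> u \<and> i \<noteq> u \<and> f i = f j)" using p_cl[of j] ij by auto
    have 3: "\<not> (j = p i \<and> j \<noteq> u \<and> i \<noteq> u \<and> f i = f j)" using p_cl[of i] ij by auto
    show ?thesis
    proof (cases "i = u \<or> j = u")
      case True
      then show ?thesis using E[OF ij] by (auto simp: algebra_simps)
    next
      case False
      then have e: "of_bool (E i j) = of_bool (i = p j) + of_bool (j = p i) + of_bool (f i = f j)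
          - (of_bool (j = i) :: real)"
        using E[OF ij] 1 2 3 by (cases "i = j") auto
      have u1: "of_bool (i \<noteq> u) = (1::real)" "of_bool (j \<noteq> u) = (1::real)" using False by auto
      have "a * ((b1 + b2 + b3 - b4) * c) = 1 * (b1 * (a * c)) + 1 * (b2 * (a * c))
          + 1 * (1 * (b3 * (a * c))) - 1 * (b4 * (a * c))" for a b1 b2 b3 b4 c :: real
        by (simp add: algebra_simps)
      then show ?thesis unfolding e u1 .
    qed
  qed
  have s2: "(\<Sum>i = 0..<k. \<Sum>j = 0..<k. ?t2 i j) = (\<Sum>v\<in>?A. x (p v) * x v)"
  proof -
    have "(\<Sum>i = 0..<k. \<Sum>j = 0..<k. ?t2 i j) = (\<Sum>i\<in>?A. \<Sum>j = 0..<k. of_bool (j = p i) * (x i * x j))"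
      unfolding sum_distrib_left[symmetric] sum_remove_vertex ..
    also have "\<dots> = (\<Sum>v\<in>?A. x (p v) * x v)"
    proof (rule sum.cong[OF refl])
      fix i assume "i \<in> ?A"
      then have "p i < k" using p by auto
      moreover have "(\<Sum>j = 0..<k. of_bool (j = p i) * (x i * x j)) =
          (\<Sum>j = 0..<k. if j = p i then x (p i) * x i else 0)" by (intro sum.cong) auto
      ultimately show "(\<Sum>j = 0..<k. of_bool (j = p i) * (x i * x j)) = x (p i) * x i" by simp
    qed
    finally show ?thesis .
  qed
  have s1: "(\<Sum>i = 0..<k. \<Sum>j = 0..<k. ?t1 i j) = (\<Sum>v\<in>?A. x (p v) * x v)"
    unfolding s2[symmetric] by (subst sum.swap) (simp add: mult.commute[of "x _" "x _"])
  have s3: "(\<Sum>i = 0..<k. \<Sum>j = 0..<k. ?t3 i j) = weight_sq_sum k x ?A f"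
    unfolding weight_sq_sum_eq_pair_sum[OF finite_Diff[OF finite_atLeastLessThan] f]
      sum_distrib_left[symmetric] sum_remove_vertex ..
  have s4: "(\<Sum>i = 0..<k. \<Sum>j = 0..<k. ?t4 i j) = (\<Sum>v\<in>?A. (x v)\<^sup>2)"
  proof -
    have "(\<Sum>i = 0..<k. \<Sum>j = 0..<k. ?t4 i j) = (\<Sum>i\<in>?A. \<Sum>j = 0..<k. of_bool (j = i) * (x i * x j))"
      unfolding sum_distrib_left[symmetric] sum_remove_vertex ..
    also have "\<dots> = (\<Sum>v\<in>?A. (x v)\<^sup>2)"
    proof (rule sum.cong[OF refl])
      fix i assume "i \<in> ?A"
      moreover have "(\<Sum>j = 0..<k. of_bool (j = i) * (x i * x j)) =
          (\<Sum>j = 0..<k. if j = i then (x i)\<^sup>2 else 0)" by (intro sum.cong) (auto simp: power2_eq_square)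
      ultimately show "(\<Sum>j = 0..<k. of_bool (j = i) * (x i * x j)) = (x i)\<^sup>2" by simp
    qed
    finally show ?thesis .
  qed
  have "adj_form k E x = (\<Sum>i = 0..<k. \<Sum>j = 0..<k. ?t1 i j + ?t2 i j + ?t3 i j - ?t4 i j)"
    unfolding adj_form_def nbr_sum_def sum_distrib_left using split by (intro sum.cong) auto
  then show ?thesis
    unfolding sum_subtractf sum.distrib s1 s2 s3 s4 by simp
qed

lemma adj_form_fan:
  assumes "u < k" "f ` ({0..<k} - {u}) \<subseteq> {0..<k}"
  shows "adj_form k (fan k u f) x = 2 * (\<Sum>v\<in>{0..<k} - {u}. x u * x v)
    + weight_sq_sum k x ({0..<k} - {u}) f - (\<Sum>v\<in>{0..<k} - {u}. (x v)\<^sup>2)"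
  by (rule adj_form_rooted[where p = "\<lambda>_. u"]) (use assms in \<open>auto simp: fan_def\<close>)

text \<open>The closed neighbourhood of the centre is everything, so \<open>x r = x u\<close> forces the closed
  neighbourhood of \<open>r\<close> to be everything as well.\<close>
lemma fan_eigenvector_centre:
  assumes x: "\<And>i. i < k \<Longrightarrow> x i > 0"
    and eig: "\<And>i. i < k \<Longrightarrow> nbr_sum k (fan k u f) x i = \<mu> * x i"
    and r: "r < k" "r \<noteq> u" "x r = x u" and u: "u < k" and v: "v < k" "v \<noteq> u"
  shows "f v = f r"
proof (rule ccontr)
  assume ne: "f v \<noteq> f r"
  \<comment> \<open>With the own entry added, the eigenvalue equations at \<open>u\<close> and
    \<open>r\<close> give closed neighbourhood sums \<open>(\<mu> + 1) * x u\<close> and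
    \<open>(\<mu> + 1) * x r\<close>, which are equal.\<close>
  have "nbr_sum k (fan k u f) x u + x u = (\<Sum>j = 0..<k. x j)"
  proof -
    have "(\<Sum>j = 0..<k. x j) = (\<Sum>j = 0..<k. of_bool (fan k u f u j) * x j + (if j = u then x u else 0))"
      using u by (intro sum.cong) (auto simp: fan_def)
    then show ?thesis using u by (simp add: sum.distrib nbr_sum_def)
  qed
  moreover have "nbr_sum k (fan k u f) x r + x r = (\<Sum>j = 0..<k. of_bool (j = r \<or> j = u \<or> f j = f r) * x j)"
  proof -
    have "(\<Sum>j = 0..<k. of_bool (j = r \<or> j = u \<or> f j = f r) * x j) =
        (\<Sum>j = 0..<k. of_bool (fan k u f r j) * x j + (if j = r then x r else 0))"
      using r by (intro sum.cong) (auto simp: fan_def)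
    then show ?thesis using r by (simp add: sum.distrib nbr_sum_def)
  qed
  ultimately have "(\<Sum>j = 0..<k. x j) = (\<Sum>j = 0..<k. of_bool (j = r \<or> j = u \<or> f j = f r) * x j)"
    using eig[OF u] eig[OF r(1)] r(3) by simp
  moreover have "(\<Sum>j = 0..<k. of_bool (j = r \<or> j = u \<or> f j = f r) * x j) < (\<Sum>j = 0..<k. x j)"
  proof (rule sum_strict_mono_ex1)
    show "\<forall>j\<in>{0..<k}. of_bool (j = r \<or> j = u \<or> f j = f r) * x j \<le> x j"
      using x by (auto simp: less_imp_le)
    show "\<exists>j\<in>{0..<k}. of_bool (j = r \<or> j = u \<or> f j = f r) * x j < x j"
      using v x ne by (intro bexI[of _ v]) auto
  qed simp
  ultimately show False by simp
qed

section \<open>Comparison of spectral radii\<close>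

lemma Bl_two: "G \<in> Bl 2 \<phi> \<Longrightarrow> G = B_graph 2 \<phi>"
proof -
  assume "G \<in> Bl 2 \<phi>"
  then have bg: "block_graph 2 G" by (simp add: Bl_def)
  then interpret rooted_block_graph 2 G 0 by unfold_locales auto
  obtain v where v: "G 0 v" using root_nbr_exists by auto
  then have "v = 1" using bounds(2)[OF v] irrefl[of 0] by (cases "v = 0") auto
  then have e: "G 0 1" "G 1 0" using v sym by auto
  show ?thesis
  proof (intro ext)
    fix x y
    show "G x y = B_graph 2 \<phi> x y"
      using bounds[of x y] irrefl[of x] e by (auto simp: B_graph_def less_2_cases_iff)
  qed
qed

text \<open>At the leaf \<open>x v = \<mu> * x u \<le> x u\<close>, so \<open>\<mu> \<le> 1\<close>.
  But \<open>v\<close> has a further neighbour \<open>w\<close>, whence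
  \<open>x v \<ge> \<mu> * x v \<ge> x u + x w > x u\<close>.\<close>

lemma leaf_not_perron_max:
  assumes G: "simple_graph_on k G" and conn: "connected_on G {0..<k}" and k: "k \<ge> 3"
    and x: "\<And>i. i < k \<Longrightarrow> x i > 0" and eig: "\<And>i. i < k \<Longrightarrow> nbr_sum k G x i = \<mu> * x i"
    and u: "u < k" "\<And>i. i < k \<Longrightarrow> x i \<le> x u" and leaf: "\<And>w. G u w \<longleftrightarrow> w = v"
  shows False
proof -
  have uv: "G u v" using leaf by simp
  have vk: "v < k" "v \<noteq> u" "G v u" using uv G by (auto simp: simple_graph_on_def)
  \<comment> \<open>Otherwise \<open>u\<close> and \<open>v\<close> would form a whole component,
    although there are at least three vertices.\<close>
  have "\<exists>w. G v w \<and> w \<noteq> u"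
  proof (rule ccontr)
    assume no: "\<not> (\<exists>w. G v w \<and> w \<noteq> u)"
    have "w = u \<or> w = v" if "w < k" for w
    proof -
      have "(\<lambda>a b. G a b \<and> a \<in> {0..<k} \<and> b \<in> {0..<k})\<^sup>*\<^sup>* u w"
        using conn u that by (auto simp: connected_on_def)
      then show ?thesis by (induction rule: rtranclp_induct) (use leaf no in auto)
    qed
    then have "{0..<k} \<subseteq> {u, v}" by (intro subsetI) (metis atLeastLessThan_iff insertCI)
    then have "card {0..<k} \<le> card {u, v}" by (intro card_mono) auto
    then show False using k vk by simp
  qed
  then obtain w where w: "G v w" "w \<noteq> u" by blast
  have wk: "w < k" using w G by (auto simp: simple_graph_on_def)
  have "nbr_sum k G x u = (\<Sum>j = 0..<k. if j = v then x v else 0)"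
    unfolding nbr_sum_def by (intro sum.cong) (auto simp: leaf)
  then have 1: "x v = \<mu> * x u" using eig[OF u(1)] vk by simp
  have "(\<Sum>j\<in>{u, w}. of_bool (G v j) * x j) \<le> nbr_sum k G x v"
    unfolding nbr_sum_def using u wk x by (intro sum_mono2) (auto simp: less_imp_le)
  then have "x u + x w \<le> nbr_sum k G x v" using w vk by simp
  then have 2: "x u < \<mu> * x v" using eig[OF vk(1)] x[OF wk] by simp
  have "\<mu> * x u \<le> 1 * x u" using 1 u(2)[OF vk(1)] by simp
  then have "\<mu> \<le> 1" using x[OF u(1)] by (simp only: mult_le_cancel_right_pos)
  then have "\<mu> * x v \<le> x v" using x[OF vk(1)] by simp
  then show False using 2 u(2)[OF vk(1)] by linarith
qed

text \<open>The chain evaluates four forms at the Perron vector of \<open>G\<close>: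
  \<open>G\<close> itself, the fan of \<open>label\<close>, the fan of a maximising labelling
  \<open>g\<close>, and the Rayleigh bound for \<open>B_graph\<close>. Equality of the ends makes
  every link tight.\<close>

lemma Bl_spectral_radius_le:
  assumes k: "k \<ge> 3" and \<phi>: "\<phi> \<ge> 2" and G: "G \<in> Bl k \<phi>"
  shows "\<phi> < k"
    and "graph_spectral_radius k G \<le> graph_spectral_radius k (B_graph k \<phi>)"
    and "graph_spectral_radius k G = graph_spectral_radius k (B_graph k \<phi>) \<Longrightarrow>
      graph_iso k G (B_graph k \<phi>)"
proof -
  let ?B = "B_graph k \<phi>" and ?\<rho> = "graph_spectral_radius k"
  have k0: "k > 0" using k by simp
  have bg: "block_graph k G" and dn: "dissociation_number k G = \<phi>" using G by (auto simp: Bl_def)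
  have sg: "simple_graph_on k G" and conn: "connected_on G {0..<k}"
    using bg by (auto simp: block_graph_def)
  obtain x where x: "\<And>i. i < k \<Longrightarrow> 0 < x i" and eig: "\<And>i. i < k \<Longrightarrow> nbr_sum k G x i = ?\<rho> G * x i"
    using perron_vector_exists[OF k0 sg conn] by metis
  have "Max (x ` {0..<k}) \<in> x ` {0..<k}" using k by (intro Max_in) auto
  then obtain u where u: "u < k" and "x u = Max (x ` {0..<k})" by auto
  then have umax: "x i \<le> x u" if "i < k" for i using that by simp
  interpret rooted_block_graph k G u using bg u by unfold_locales
  let ?A = "{0..<k} - {u}"
  let ?W = "weight_sq_sum k x ?A"
  have lab: "label ` ?A \<subseteq> {0..<k}" using label_less by auto
  have "\<phi> \<in> card ` {D. dissociation_set k G D}"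
    unfolding dn[symmetric] dissociation_number_def
  proof (rule Max_in)
    have "dissociation_set k G {}" by (simp add: dissociation_set_def)
    then show "card ` {D. dissociation_set k G D} \<noteq> {}" by blast
  qed (intro finite_imageI finite_dissociation_sets)
  then obtain D where D: "dissociation_set k G D" "card D = \<phi>" by auto
  \<comment> \<open>Otherwise \<open>u\<close> would be a leaf, which the choice of \<open>u\<close>
    as a largest Perron entry excludes.\<close>
  have cap: "\<phi> \<le> capped_size_sum k ?A label"
  proof (rule ccontr)
    assume "\<not> ?thesis"
    then have "card D > capped_size_sum k ?A label" using D by simp
    then obtain v where "\<And>w. G u w \<longleftrightarrow> w = v"
      using root_leaf_if_dissociation_exceeds[OF _ D(1)] k by force
    then show False using leaf_not_perron_max[OF sg conn k x eig u umax] by blast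
  qed
  also have "\<dots> \<le> card ?A" using lab by (intro capped_size_sum_le_card) auto
  finally show \<phi>k: "\<phi> < k" using u by (simp add: card_Diff_singleton)
  \<comment> \<open>The gain from replacing each edge between \<open>v\<close> and its parent by one
    between \<open>v\<close> and \<open>u\<close>; the factor 2 counts both orientations.\<close>
  let ?d = "2 * (\<Sum>v\<in>?A. (x u - x (parent v)) * x v)"
  have formG: "adj_form k G x = adj_form k (fan k u label) x - ?d"
  proof -
    have "adj_form k G x = 2 * (\<Sum>v\<in>?A. x (parent v) * x v) + ?W label - (\<Sum>v\<in>?A. (x v)\<^sup>2)"
    proof (rule adj_form_rooted[OF lab edge_iff parent_less label_neq_parent])
      fix v assume v: "v < k" "v \<noteq> u" "parent v \<noteq> u"
      then show "parent (parent v) \<noteq> v"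
        using parent(2)[OF v(1,2)] parent(2)[OF parent_less[OF v(1,2)] v(3)] by auto
    qed
    then show ?thesis
      unfolding adj_form_fan[OF u lab] by (simp add: left_diff_distrib sum_subtractf)
  qed
  have dpos: "(x u - x (parent v)) * x v \<ge> 0" if "v \<in> ?A" for v
    using that umax[OF parent_less[of v]] x[of v] by simp
  have d0: "?d \<ge> 0"
    using sum_nonneg[of ?A "\<lambda>v. (x u - x (parent v)) * x v", OF dpos] by simp
  obtain g where g: "g ` ?A \<subseteq> {0..<k}" "capped_size_sum k ?A g \<ge> \<phi>"
    and gmax: "\<And>h. h ` ?A \<subseteq> {0..<k} \<Longrightarrow> capped_size_sum k ?A h \<ge> \<phi> \<Longrightarrow> ?W h \<le> ?W g"
    by (rule maximizer_exists[OF finite_Diff[OF finite_atLeastLessThan] lab cap, of x]) blast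
  \<comment> \<open>Stated for every maximising labelling: it is applied to \<open>g\<close> and, in
    the equality case, to \<open>label\<close> itself.\<close>
  have fan_B: "?\<rho> (fan k u h) \<le> ?\<rho> ?B" "graph_iso k (fan k u h) ?B"
    if h: "h ` ?A \<subseteq> {0..<k}" "capped_size_sum k ?A h \<ge> \<phi>" "?W h = ?W g" for h :: "nat \<Rightarrow> nat"
  proof -
    have "extremal_shape \<phi> k ?A h"
      by (rule maximizer_extremal_shape[of ?A x]) (use x \<phi> h gmax in auto)
    then show iso: "graph_iso k (fan k u h) ?B" using fan_iso_B_graph[OF u \<phi> \<phi>k h(1)] by blast
    show "?\<rho> (fan k u h) \<le> ?\<rho> ?B"
      by (rule graph_iso_spectral_radius_le[OF k0 _ _ graph_iso_sym[OF iso]])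
        (auto simp: B_graph_eq_fan intro: fan_sym)
  qed
  have pos: "sq_sum k x > 0" using u x[OF u] by (intro sq_sum_pos[of u]) auto
  have formG': "adj_form k G x = ?\<rho> G * sq_sum k x" using eig by (rule adj_form_eigenvector)
  have Wle: "?W label \<le> ?W g" using gmax lab cap by blast
  have fan_le: "adj_form k (fan k u h) y \<le> ?\<rho> (fan k u h) * sq_sum k y" for h :: "nat \<Rightarrow> nat" and y
    by (rule adj_form_le_spectral_radius[OF k0]) (rule fan_sym)
  have "adj_form k (fan k u g) x \<le> ?\<rho> (fan k u g) * sq_sum k x" by (rule fan_le)
  also have "\<dots> \<le> ?\<rho> ?B * sq_sum k x"
    using fan_B(1)[OF g refl] pos by simp
  finally have chain: "adj_form k (fan k u g) x \<le> ?\<rho> ?B * sq_sum k x" .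
  have diff: "adj_form k (fan k u g) x = adj_form k (fan k u label) x + (?W g - ?W label)"
    unfolding adj_form_fan[OF u g(1)] adj_form_fan[OF u lab] by simp
  have "?\<rho> G * sq_sum k x \<le> ?\<rho> ?B * sq_sum k x"
    using chain diff formG formG' d0 Wle by linarith
  then show "?\<rho> G \<le> ?\<rho> ?B" using pos by simp
  show "graph_iso k G ?B" if eq: "?\<rho> G = ?\<rho> ?B"
  proof -
    have formB: "adj_form k G x = ?\<rho> ?B * sq_sum k x" using formG' eq by simp
    have W: "?W label = ?W g" using chain diff formG formB d0 Wle by linarith
    have dz: "?d = 0" using chain diff formG formB d0 Wle by linarith
    have iso: "graph_iso k (fan k u label) ?B" and le: "?\<rho> (fan k u label) \<le> ?\<rho> ?B"
      using fan_B[OF lab cap W] by auto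
    have "?\<rho> (fan k u label) * sq_sum k x \<le> ?\<rho> ?B * sq_sum k x" using le pos by simp
    \<comment> \<open>\<open>x\<close> attains the Rayleigh bound of the fan, so it is an
      eigenvector of the fan as well.\<close>
    then have fx: "adj_form k (fan k u label) x = ?\<rho> (fan k u label) * sq_sum k x"
      using fan_le[of label x] formG formB dz by linarith
    have feig: "nbr_sum k (fan k u label) x i = ?\<rho> (fan k u label) * x i" if "i < k" for i
      using that fan_sym
      by (intro rayleigh_maximizer_eigenvector[where E = "fan k u label", OF _ fan_le fx])
    have zero: "(x u - x (parent v)) * x v = 0" if "v \<in> ?A" for v
      using dz that sum_nonneg_eq_0_iff[of ?A "\<lambda>v. (x u - x (parent v)) * x v"] dpos by simp
    \<comment> \<open>A parent other than \<open>u\<close> would share the maximal entry, so by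
      \<open>fan_eigenvector_centre\<close> it would carry the label of its child.\<close>
    have par: "parent v = u" if v: "v < k" "v \<noteq> u" for v
    proof (rule ccontr)
      assume r: "parent v \<noteq> u"
      have "x (parent v) = x u" using zero[of v] v x[OF v(1)] by simp
      from fan_eigenvector_centre[OF x feig parent_less[OF v] r this u v]
      show False using label_neq_parent[OF v] by simp
    qed
    have "G i j = fan k u label i j" for i j
    proof (cases "i < k \<and> j < k")
      case True
      then show ?thesis
        using edge_iff[of i j] par[of i] par[of j] by (auto simp: fan_def)
    next
      case False
      then show ?thesis using bounds[of i j] by (auto simp: fan_def)
    qed
    then have "G = fan k u label" by blast
    then show ?thesis using iso by simp
  qed
qed

theorem theorem3p7:
  fixes k \<phi> :: nat and G :: "nat \<Rightarrow> nat \<Rightarrow> bool"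
  assumes "k \<ge> 2" and "\<phi> \<ge> 2" and "Bl k \<phi> \<noteq> {}"
    and "G \<in> Bl k \<phi>"
  shows "max_spectral_radius_in k \<phi> G \<longleftrightarrow> graph_iso k G (B_graph k \<phi>)"
proof (cases "k = 2")
  case True
  \<comment> \<open>On two vertices the only connected graph is an edge, so both sides hold. Here
    the dissociation number equals \<open>k\<close>, so this case lies outside the bound
    \<open>\<phi> < k\<close> used for larger graphs.\<close>
  have "E = B_graph 2 \<phi>" if "E \<in> Bl 2 \<phi>" for E using Bl_two that by blast
  moreover have "graph_iso k (B_graph k \<phi>) (B_graph k \<phi>)"
    unfolding graph_iso_def by (rule exI[of _ id]) simp
  ultimately show ?thesis using True assms(4) unfolding max_spectral_radius_in_def by auto
next
  case False
  then have k: "k \<ge> 3" using assms(1) by simp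
  note main = Bl_spectral_radius_le[OF k assms(2)]
  \<comment> \<open>The existence of \<open>G\<close> gives \<open>\<phi> < k\<close>, which makes
    \<open>B_graph\<close> a competitor in the class.\<close>
  have "B_graph k \<phi> \<in> Bl k \<phi>" using B_graph_in_Bl main(1)[OF assms(4)] assms(2) by blast
  moreover have "graph_spectral_radius k (B_graph k \<phi>) \<le> graph_spectral_radius k G"
    if "graph_iso k G (B_graph k \<phi>)"
  proof (rule graph_iso_spectral_radius_le[OF _ _ _ that])
    show "G j i" if "G i j" for i j
      using that assms(4) by (auto simp: Bl_def block_graph_def simple_graph_on_def)
  qed (use k in \<open>auto simp: B_graph_eq_fan intro: fan_sym\<close>)
  ultimately show ?thesis
    using main(2) main(3)[OF assms(4)] assms(4) unfolding max_spectral_radius_in_def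
    by (meson order_antisym order_trans)
qed

end
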